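(* Let $\mu,\nu,s\in\mathbb{C}$ and $x\in(-1,1)$. (1) The identity $$\sum_{n=0}^{\infty}(\mu-\nu)_n\,P_{n-\nu-1}^{-\mu}(x)\,\frac{s^n}{n!}=\left(1-2sx+s^2\right)^{\frac\nu2}\,\widehat{P}_\nu^{-\mu}\left(\frac{x-s}{\sqrt{1-2sx+s^2}}\right)$$ holds for all $s\in\mathbb{C}$ if $\nu-\mu\in\mathbb{N}_0$, and for $|s|<1$ if $\nu-\mu\notin\mathbb{N}_0$. If $|s|=1$ and $\nu-\mu\notin\mathbb{N}_0$, it is valid either when $\operatorname{Re}\nu>\frac12$, or when $-\frac12<\operatorname{Re}\nu\le\frac12$ and $\arg s\ne\pm\arccos x$. (2) The identity $$\sum_{n=0}^{\infty}\frac{P_\nu^{n-\mu}(x)}{(1-x^2)^{\frac{n-\mu}{2}}}\,\frac{s^n}{n!}=\left(1-(x-s)^2\right)^{\frac\mu2}\,\widehat{P}_\nu^{-\mu}(x-s)$$ holds: for all $s\in\mathbb{C}$ if $\nu,\mu\in\mathbb{Z}$; if $\nu,\mu\notin\mathbb{Z}$, for $|s|\le1-|x|$ when $\operatorname{Re}\mu>0$ and for $|s|<1-|x|$ when $\operatorname{Re}\mu\le0$; if $\nu\in\mathbb{Z}$ and $\mu\notin\mathbb{Z}$, for $|s|\le1+x$ when $\operatorname{Re}\mu>0$ and for $|s|<1+x$ when $\operatorname{Re}\mu\le0$; if $\mu\in\mathbb{Z}$ and $\nu\notin\mathbb{Z}$, for $|s|\le1-x$ when $\operatorname{Re}\mu>0$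 and for $|s|<1-x$ when $\operatorname{Re}\mu\le0$. (3) The identity $$\sum_{n=0}^{\infty}P_\nu^{n-\mu}(x)\,\frac{s^n}{n!}=\left(1+\frac{2sx}{\sqrt{1-x^2}}-s^2\right)^{\frac\mu2}\,\widehat{P}_\nu^{-\mu}\left(x-s\sqrt{1-x^2}\right)$$ holds: for all $s\in\mathbb{C}$ if $\nu,\mu\in\mathbb{Z}$; if $\nu,\mu\notin\mathbb{Z}$, for $|s|\le\frac{\sqrt{1-|x|}}{\sqrt{1+|x|}}$ when $\operatorname{Re}\mu>0$ and for $|s|<\frac{\sqrt{1-|x|}}{\sqrt{1+|x|}}$ when $\operatorname{Re}\mu\le0$; if $\nu\in\mathbb{Z}$ and $\mu\notin\mathbb{Z}$, for $|s|\le\frac{\sqrt{1+x}}{\sqrt{1-x}}$ when $\operatorname{Re}\mu>0$ and for $|s|<\frac{\sqrt{1+x}}{\sqrt{1-x}}$ when $\operatorname{Re}\mu\le0$; if $\mu\in\mathbb{Z}$ and $\nu\notin\mathbb{Z}$, for $|s|\le\frac{\sqrt{1-x}}{\sqrt{1+x}}$ when $\mu>0$ and for $|s|<\frac{\sqrt{1-x}}{\sqrt{1+x}}$ when $\mu\le0$.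
   Context: For $x\in(-1,1)$ and $\nu,\mu\in\mathbb{C}$ the Ferrers function of the first kind is $P_\nu^{-\mu}(x)=\left(\frac{1-x}{1+x}\right)^{\mu/2}\frac{F(-\nu,\nu+1;1+\mu;\frac{1-x}{2})}{\Gamma(1+\mu)}$, where $F$ is the Gauss hypergeometric function and $F(a,b;c;z)/\Gamma(c)$ is read as $\sum_k \frac{(a)_k(b)_k}{\Gamma(c+k)k!}z^k$, entire in $c$; it is entire in each of $\nu,\mu$. $P_\nu^\sigma$ denotes this function with $\mu=-\sigma$. $(a)_n=\Gamma(a+n)/\Gamma(a)$, $\mathbb{N}_0=\{0,1,2,\dots\}$. $\widehat{P}_\nu^{-\mu}(z)$ denotes the analytic continuation of $P_\nu^{-\mu}(x)$ from $(-1,1)$ to the complex $z$-plane with cuts connecting the branch points $z=\pm1$ with the point at infinity. The right-hand sides are understood, as functions of $s$, by analytic continuation from $s=0$, where the powers and roots have their principal values.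
   Formalization: In (2), (3) the radii of the two mixed cases are interchanged: for ν∈ℤ, μ∉ℤ it is 1-x (in (3) √(1-x)/√(1+x)); for μ∈ℤ, ν∉ℤ it is 1+x (in (3) √(1+x)/√(1-x)). As printed it fails: for ν=0, μ=x=1/2 the series in (2) diverges when |s|>1/2. *)

theory Defs
  imports "HOL-Complex_Analysis.Complex_Analysis"
begin

text \<open>
  The function \<open>F(a,b;c;z) / \<Gamma>(c)\<close>. Since \<open>rGamma\<close> is entire, the coefficients make sense for
  every \<open>c\<close>, including the non-positive integers.
\<close>

definition hypergeo_reg :: "complex \<Rightarrow> complex \<Rightarrow> complex \<Rightarrow> complex \<Rightarrow> complex" where
  "hypergeo_reg a b c z =
     (\<Sum>k. pochhammer a k * pochhammer b k * rGamma (c + of_nat k) / fact k * z ^ k)"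

text \<open>
  \<open>ferrersP \<nu> \<sigma> x\<close> is \<open>P\<^sub>\<nu>\<^sup>\<sigma>(x)\<close>, with upper index \<open>\<sigma>\<close> (so that \<open>\<mu> = -\<sigma>\<close> in the
  usual formula for \<open>P\<^sub>\<nu>\<^sup>-\<^sup>\<mu>\<close>). Only meaningful for \<open>-1 < x < 1\<close>.
\<close>

definition ferrersP :: "complex \<Rightarrow> complex \<Rightarrow> real \<Rightarrow> complex" where
  "ferrersP \<nu> \<sigma> x =
     complex_of_real ((1 - x) / (1 + x)) powr (- \<sigma> / 2) *
     hypergeo_reg (- \<nu>) (\<nu> + 1) (1 - \<sigma>) (complex_of_real ((1 - x) / 2))"

definition cut_plane :: "complex set" where
  "cut_plane = - (complex_of_real ` ({..-1} \<union> {1..}))"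

text \<open>
  The analytic continuation of \<open>ferrersP \<nu> \<sigma>\<close> from \<open>(-1,1)\<close> to the cut plane. It exists because
  the hypergeometric function continues to \<open>\<complex> - [1,\<infinity>)\<close>, and by the identity theorem it is uniquely
  determined on \<open>cut_plane\<close>; its values on the cuts are unspecified.
\<close>

definition ferrersP_hat :: "complex \<Rightarrow> complex \<Rightarrow> complex \<Rightarrow> complex" where
  "ferrersP_hat \<nu> \<sigma> =
     (SOME f. f holomorphic_on cut_plane \<and>
              (\<forall>x\<in>{-1<..<1}. f (complex_of_real x) = ferrersP \<nu> \<sigma> x))"

text \<open>
  \<open>continuation_from_0 f D g\<close>: \<open>g\<close> is the analytic continuation to \<open>D\<close> of the germ of \<open>f\<close> at \<open>0\<close>.
  For \<open>D\<close> a disc together with part of its boundary circle, the values of \<open>g\<close> at the boundary points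
  are those obtained by continuity from the interior; this agrees with analytic continuation wherever
  the latter is possible, and also covers the branch points of \<open>f\<close> on the circle. For such \<open>D\<close>
  containing \<open>0\<close> in the interior, \<open>g\<close> is uniquely determined on \<open>D\<close>.
\<close>

definition continuation_from_0 ::
    "(complex \<Rightarrow> complex) \<Rightarrow> complex set \<Rightarrow> (complex \<Rightarrow> complex) \<Rightarrow> bool" where
  "continuation_from_0 f D g \<longleftrightarrow>
     g holomorphic_on interior D \<and> continuous_on D g \<and> (\<forall>\<^sub>F s in nhds 0. g s = f s)"

definition exp_generating_on ::
    "complex set \<Rightarrow> (nat \<Rightarrow> complex) \<Rightarrow> (complex \<Rightarrow> complex) \<Rightarrow> bool" where
  "exp_generating_on D a f \<longleftrightarrow>
     (\<exists>g. continuation_from_0 f D g \<and> (\<forall>s\<in>D. (\<lambda>n. a n * (s ^ n / fact n)) sums g s))"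

text \<open>The disc of radius \<open>r\<close>, closed if \<open>Re \<mu> > 0\<close> and open otherwise.\<close>

definition mu_disc :: "complex \<Rightarrow> real \<Rightarrow> complex set" where
  "mu_disc \<mu> r = (if Re \<mu> > 0 then cball 0 r else ball 0 r)"

end

theory Submission
  imports Defs "HOL-Real_Asymp.Real_Asymp"
begin

text \<open>
  Each right-hand side is the first member of a family \<open>F\<^sub>0, F\<^sub>1, \<dots>\<close> of functions with
  \<open>F\<^sub>n' = F\<^sub>n\<^sub>+\<^sub>1\<close>, so the left-hand side is its Taylor series at 0. In (1) this is
  \<open>F\<^sub>n(s) = (\<mu> - \<nu>)\<^sub>n R\<^sup>\<nu>\<^sup>-\<^sup>n P\<^sub>\<nu>\<^sub>-\<^sub>n\<^sup>-\<^sup>\<mu>((x - s)/R)\<close> with \<open>R\<^sup>2 = 1 - 2sx + s\<^sup>2\<close>; in (2) it is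
  \<open>F\<^sub>n(s) = J\<^sub>\<mu>\<^sub>-\<^sub>n(x - s)\<close>, where \<open>J\<^sub>\<mu>(u) = (1 - u\<^sup>2)\<^sup>\<mu>\<^sup>/\<^sup>2 P\<^sub>\<nu>\<^sup>-\<^sup>\<mu>(u)\<close> satisfies
  \<open>J\<^sub>\<mu>' = -J\<^sub>\<mu>\<^sub>-\<^sub>1\<close>. Part (3) is (2) after scaling \<open>s\<close> by \<open>\<surd>(1 - x\<^sup>2)\<close>.

  The radius of convergence, and absolute convergence on the boundary circle, follow from the
  three-term recurrence in the degree (for (1)) or the order (for (2)): it is a perturbation of size
  \<open>O(n\<^sup>-\<^sup>2)\<close> of a product of two first-order recurrences, which gives coefficients of size
  \<open>L\<^sup>n n\<^sup>-\<^sup>\<rho>\<close>. For integral \<open>\<nu>\<close> or \<open>\<mu>\<close> one of the two singularities disappears, and the larger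
  disc is obtained from the polynomial, respectively the power series at \<open>u = 1\<close>, directly.

  The continuation of \<open>P\<^sub>\<nu>\<^sup>-\<^sup>\<mu>\<close> to the cut plane exists because \<open>(P\<^sub>\<nu>, P\<^sub>\<nu>\<^sub>-\<^sub>1)\<close> solves a linear
  first-order system with coefficients holomorphic on the cut plane, which is star-shaped about 0.
\<close>


lemma raabe_summable:
  fixes a :: "nat \<Rightarrow> real"
  assumes nn: "\<And>n. a n \<ge> 0" and \<rho>: "\<rho> > 1"
    and ev: "\<forall>\<^sub>F n in sequentially. (real n + 1) * a (Suc n) \<le> (real n + 1 - \<rho>) * a n"
  shows "summable a"
proof -
  obtain N where N: "\<And>n. n \<ge> N \<Longrightarrow> (real n + 1) * a (Suc n) \<le> (real n + 1 - \<rho>) * a n"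
    using ev by (auto simp: eventually_sequentially)
  have tele: "(\<rho> - 1) * (\<Sum>i<m. a (i + N)) \<le> real N * a N - real (m + N) * a (m + N)" for m
  proof (induction m)
    case (Suc m)
    have "(\<rho> - 1) * a (m + N) \<le> real (m + N) * a (m + N) - real (Suc m + N) * a (Suc m + N)"
      using N[of "m + N"] by (simp add: algebra_simps)
    then show ?case using Suc by (simp add: algebra_simps)
  qed simp
  have "summable (\<lambda>i. a (i + N))"
  proof (rule bounded_imp_summable[of _ "real N * a N / (\<rho> - 1)"])
    fix m
    have "(\<rho> - 1) * (\<Sum>i<Suc m. a (i + N)) \<le> real N * a N"
      using tele[of "Suc m"] nn[of "Suc m + N"] mult_nonneg_nonneg[of "real (Suc m + N)" "a (Suc m + N)"]
      by linarith
    then show "(\<Sum>i\<le>m. a (i + N)) \<le> real N * a N / (\<rho> - 1)"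
      using \<rho> by (simp add: pos_le_divide_eq mult.commute lessThan_Suc_atMost)
  qed (use nn in auto)
  then show ?thesis by (simp add: summable_iff_shift)
qed

lemma raabe_powser_summable:
  fixes S :: "nat \<Rightarrow> real"
  assumes S: "\<And>n. S n \<ge> 0" "\<forall>\<^sub>F n in sequentially. (real n + 1) * S (Suc n) \<le> (real n + 1 - \<rho>) * S n"
    and r: "0 \<le> r" "r < 1"
  shows "summable (\<lambda>n. S n * r ^ n)"
proof -
  define T where "T n = S n * r ^ n" for n
  have "\<forall>\<^sub>F n in sequentially. (real n + 1 - \<rho>) * r \<le> real n + 1 - 2"
  proof -
    have "1 - r > 0" using r by simp
    then have "\<forall>\<^sub>F n in sequentially. (1 - \<rho>) * r + 1 \<le> (1 - r) * real n" by real_asymp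
    then show ?thesis by eventually_elim (simp add: algebra_simps)
  qed
  then have "\<forall>\<^sub>F n in sequentially. (real n + 1) * T (Suc n) \<le> (real n + 1 - 2) * T n"
    using S(2)
  proof eventually_elim
    case (elim n)
    have "(real n + 1) * T (Suc n) = ((real n + 1) * S (Suc n)) * r ^ Suc n" by (simp add: T_def)
    also have "\<dots> \<le> ((real n + 1 - \<rho>) * S n) * r ^ Suc n" using elim r by (intro mult_right_mono) auto
    also have "\<dots> = ((real n + 1 - \<rho>) * r) * T n" by (simp add: T_def)
    also have "\<dots> \<le> (real n + 1 - 2) * T n" using elim r S(1) by (intro mult_right_mono) (auto simp: T_def)
    finally show ?case .
  qed
  then have "summable T" using S(1) r by (intro raabe_summable[of T 2]) (auto simp: T_def)
  then show ?thesis by (simp add: T_def[abs_def])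
qed

lemma eventually_norm_of_nat_add_le:
  assumes "Re z < d"
  shows "\<forall>\<^sub>F n in sequentially. norm (of_nat n + z) \<le> real n + d"
proof -
  have "\<forall>\<^sub>F n in sequentially. (Im z)\<^sup>2 \<le> 2 * (d - Re z) * (real n + Re z) \<and> 0 \<le> real n + Re z"
  proof (intro eventually_conj)
    have "d - Re z > 0" using assms by simp
    then show "\<forall>\<^sub>F n in sequentially. (Im z)\<^sup>2 \<le> 2 * (d - Re z) * (real n + Re z)"
      by real_asymp
    show "\<forall>\<^sub>F n in sequentially. 0 \<le> real n + Re z" by real_asymp
  qed
  then show ?thesis
  proof eventually_elim
    case (elim n)
    have "(real n + Re z)\<^sup>2 + (Im z)\<^sup>2 \<le> (real n + d)\<^sup>2"
      using elim sum_power2_ge_zero[of "d - Re z" 0] by (simp add: power2_eq_square algebra_simps)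
    then show ?case
      using elim assms by (auto simp: cmod_def intro!: real_le_lsqrt)
  qed
qed

lemma second_order_recurrence_growth:
  fixes c :: "nat \<Rightarrow> complex"
  assumes rec: "\<And>n. of_nat (n+1) * of_nat (n+2) * c (n+2) =
      (l1 + l2) * of_nat (n+1) * (of_nat (n+2) - k) * c (n+1)
      - l1 * l2 * ((of_nat n)\<^sup>2 + (3 - 2*k) * of_nat n + \<zeta>) * c n"
    and ne: "l1 \<noteq> l2" and l1: "norm l1 \<le> 1" and l2: "norm l2 \<le> 1" and \<rho>: "\<rho> < Re k"
  shows "\<exists>(S :: nat \<Rightarrow> real) K. (\<forall>n. S n \<ge> 0) \<and>
    (\<forall>\<^sub>F n in sequentially. norm (c n) \<le> K * S n) \<and>
    (\<forall>\<^sub>F n in sequentially. (real n + 1) * S (Suc n) \<le> (real n + 1 - \<rho>) * S n)"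
proof -
  define \<tau> where "\<tau> n = (of_nat (n+1) - k) / of_nat (n+1)" for n
  define V where "V l n = c (n+1) - l * \<tau> n * c n" for l n
  define \<delta> where "\<delta> = l1 * l2 * ((2-k)*(1-k) - \<zeta>)"
  define S where "S n = norm (V l1 n) + norm (V l2 n)" for n
  define K where "K = 2 / norm (l1 - l2)"
  have Kpos: "K > 0" using ne by (simp add: K_def)
  \<comment> \<open>Up to \<open>O(n\<^sup>-\<^sup>2)\<close> the recurrence factors into two first-order ones.\<close>
  have step: "V b (Suc n) = a * \<tau> (Suc n) * V b n + \<delta> / (of_nat (n+1) * of_nat (n+2)) * c n"
    if "(a = l1 \<and> b = l2) \<or> (a = l2 \<and> b = l1)" for a b n
  proof -
    have ab: "a + b = l1 + l2" "a * b = l1 * l2" using that by auto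
    define x where "x = (of_nat n :: complex)"
    have nz: "x + 1 \<noteq> 0" "x + 2 \<noteq> 0"
      using of_nat_neq_0[of n, where 'a=complex] of_nat_neq_0[of "Suc n", where 'a=complex]
      by (auto simp: x_def add_ac)
    have x12: "of_nat (n+1) = x+1" "of_nat (n+2) = x+2" by (simp_all add: x_def)
    have r: "(x+1)*(x+2) * c (n+2) = (a+b) * (x+1) * (x+2-k) * c (n+1) - a*b*(x\<^sup>2+(3-2*k)*x+\<zeta>) * c n"
      using rec[of n, folded x_def] by (simp only: x12 ab)
    have t: "(x+1) * \<tau> n = x+1-k" "(x+2) * \<tau> (Suc n) = x+2-k"
      using nz by (simp_all add: \<tau>_def x_def add_ac)
    have d: "(x+1) * (x+2) * (\<delta> / (of_nat (n+1) * of_nat (n+2))) = a*b*((2-k)*(1-k) - \<zeta>)"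
      unfolding x12 using nz by (simp add: \<delta>_def ab)
    have "((x+1)*(x+2)) * V b (Suc n) = (x+1)*(x+2) * c (n+2) - b * (x+1) * ((x+2) * \<tau> (Suc n)) * c (n+1)"
      by (simp add: V_def algebra_simps)
    also have "\<dots> = a * (x+1) * (x+2-k) * c (n+1) - a * b * (x+2-k)*(x+1-k) * c n + a*b*((2-k)*(1-k) - \<zeta>) * c n"
      unfolding r t by (simp add: algebra_simps power2_eq_square)
    also have "\<dots> = a * (x+1) * ((x+2) * \<tau> (Suc n)) * c (n+1) - a * b * ((x+2) * \<tau> (Suc n)) * ((x+1) * \<tau> n) * c n
        + (x+1) * (x+2) * (\<delta> / (of_nat (n+1) * of_nat (n+2))) * c n"
      unfolding t d ..
    also have "\<dots> = ((x+1)*(x+2)) * (a * \<tau> (Suc n) * V b n + \<delta> / (of_nat (n+1) * of_nat (n+2)) * c n)"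
      unfolding V_def by (simp only: algebra_simps)
    finally have "((x+1)*(x+2)) * V b (Suc n) = ((x+1)*(x+2)) * (a * \<tau> (Suc n) * V b n + \<delta> / (of_nat (n+1) * of_nat (n+2)) * c n)" .
    then show ?thesis using nz by simp
  qed
  have n\<tau>: "norm (\<tau> (Suc n)) = norm (of_nat n + (2 - k)) / (real n + 2)" for n
  proof -
    have "\<tau> (Suc n) = (of_nat n + (2 - k)) / of_nat (n + 2)" by (simp add: \<tau>_def algebra_simps)
    then show ?thesis by (simp only: norm_divide norm_of_nat) simp
  qed
  have bound: "norm (V b (Suc n)) \<le> norm (\<tau> (Suc n)) * norm (V b n) + norm \<delta> / ((real n + 1) * (real n + 2)) * norm (c n)"
    if "(a = l1 \<and> b = l2) \<or> (a = l2 \<and> b = l1)" for a b n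
  proof -
    have "norm a \<le> 1" using that l1 l2 by auto
    then have "norm a * (norm (\<tau> (Suc n)) * norm (V b n)) \<le> 1 * (norm (\<tau> (Suc n)) * norm (V b n))"
      by (intro mult_right_mono) auto
    moreover have "norm (\<delta> / (of_nat (n+1) * of_nat (n+2)) * c n) = norm \<delta> / ((real n + 1) * (real n + 2)) * norm (c n)"
      by (simp only: norm_mult norm_divide norm_of_nat) (simp add: add_ac)
    moreover have "norm (V b (Suc n)) \<le> norm a * (norm (\<tau> (Suc n)) * norm (V b n)) + norm (\<delta> / (of_nat (n+1) * of_nat (n+2)) * c n)"
      unfolding step[OF that] by (rule order_trans[OF norm_triangle_ineq]) (simp add: norm_mult mult.assoc)
    ultimately show ?thesis by simp
  qed
  have ev\<tau>: "\<forall>\<^sub>F n in sequentially. norm (\<tau> n) \<ge> 1/2"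
  proof -
    have "\<forall>\<^sub>F n in sequentially. norm k / (real n + 1) \<le> 1/2" by real_asymp
    then show ?thesis
    proof eventually_elim
      case (elim n)
      have "\<tau> n = 1 - k / of_nat (n+1)" by (simp add: \<tau>_def diff_divide_distrib del: of_nat_Suc)
      moreover have "norm (k / of_nat (n+1)) \<le> 1/2" using elim by (simp add: norm_divide add_ac del: of_nat_Suc) (simp add: add_ac)?
      ultimately show ?case using norm_triangle_ineq2[of 1 "k / of_nat (n+1)"] by simp
    qed
  qed
  have cS: "\<forall>\<^sub>F n in sequentially. norm (c n) \<le> K * S n"
    using ev\<tau>
  proof eventually_elim
    case (elim n)
    have "(l1 - l2) * \<tau> n * c n = V l2 n - V l1 n" by (simp add: V_def algebra_simps)
    then have "norm (l1 - l2) * norm (\<tau> n) * norm (c n) \<le> S n"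
      unfolding S_def by (metis norm_mult norm_triangle_ineq4 add.commute)
    moreover have "norm (l1 - l2) * (1/2) * norm (c n) \<le> norm (l1 - l2) * norm (\<tau> n) * norm (c n)"
      using elim by (intro mult_right_mono mult_left_mono) auto
    ultimately show ?case using ne by (simp add: K_def field_simps)
  qed
  define d where "d = (\<rho> + Re k) / 2"
  have d: "\<rho> < d" "d < Re k" using \<rho> by (auto simp: d_def field_simps)
  define E where "E = 2 * norm \<delta> * K"
  have "\<forall>\<^sub>F n in sequentially. norm (of_nat n + (2 - k)) \<le> real n + (2 - d)"
    by (rule eventually_norm_of_nat_add_le) (use d in simp)
  moreover have "\<forall>\<^sub>F n in sequentially. (real n + 1) * (real n + 2 - d) + E \<le> (real n + 1 - \<rho>) * (real n + 2)"
  proof -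
    have "d - \<rho> > 0" using d by simp
    then have "\<forall>\<^sub>F n in sequentially. E + 2 * \<rho> - d \<le> (d - \<rho>) * real n" by real_asymp
    then show ?thesis by eventually_elim (simp add: algebra_simps)
  qed
  ultimately have "\<forall>\<^sub>F n in sequentially. (real n + 1) * S (Suc n) \<le> (real n + 1 - \<rho>) * S n"
    using cS
  proof eventually_elim
    case (elim n)
    have Snn: "S n \<ge> 0" by (simp add: S_def)
    have "S (Suc n) \<le> norm (\<tau> (Suc n)) * S n + 2 * (norm \<delta> / ((real n + 1) * (real n + 2)) * norm (c n))"
    proof -
      have "norm (V l2 (Suc n)) \<le> norm (\<tau> (Suc n)) * norm (V l2 n) + norm \<delta> / ((real n + 1) * (real n + 2)) * norm (c n)"
        and "norm (V l1 (Suc n)) \<le> norm (\<tau> (Suc n)) * norm (V l1 n) + norm \<delta> / ((real n + 1) * (real n + 2)) * norm (c n)"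
        by (rule bound[of l1 l2], simp, rule bound[of l2 l1], simp)
      then show ?thesis
        unfolding S_def distrib_left[of "norm (\<tau> (Suc n))"] by linarith
    qed
    also have "\<dots> \<le> (real n + 2 - d) / (real n + 2) * S n + 2 * (norm \<delta> / ((real n + 1) * (real n + 2)) * (K * S n))"
    proof (intro add_mono mult_right_mono mult_left_mono)
      show "norm (\<tau> (Suc n)) \<le> (real n + 2 - d) / (real n + 2)"
        unfolding n\<tau> using elim by (intro divide_right_mono) auto
    qed (use elim Snn in auto)
    also have "\<dots> = ((real n + 1) * (real n + 2 - d) + E) / ((real n + 1) * (real n + 2)) * S n"
    proof -
      have "(q - d) / q * s + 2 * (e / (p * q) * (K * s)) = (p * (q - d) + 2 * e * K) / (p * q) * s"
        if "p \<noteq> 0" "q \<noteq> 0" for p q s e :: real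
        using that by (simp add: divide_simps) (simp add: algebra_simps)
      from this[of "real n + 1" "real n + 2" "S n" "norm \<delta>"] show ?thesis by (simp add: E_def)
    qed
    also have "\<dots> \<le> ((real n + 1 - \<rho>) * (real n + 2)) / ((real n + 1) * (real n + 2)) * S n"
      using elim Snn by (intro mult_right_mono divide_right_mono) auto
    also have "\<dots> = (real n + 1 - \<rho>) / (real n + 1) * S n" by simp
    finally show ?case by (simp add: field_simps)
  qed
  moreover have "\<forall>n. S n \<ge> 0" by (simp add: S_def)
  ultimately show ?thesis using cS by blast
qed

lemma second_order_recurrence_summable:
  fixes c :: "nat \<Rightarrow> complex"
  assumes rec: "\<And>n. of_nat (n+1) * of_nat (n+2) * c (n+2) =
      (l1 + l2) * of_nat (n+1) * (of_nat (n+2) - k) * c (n+1)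
      - l1 * l2 * ((of_nat n)\<^sup>2 + (3 - 2*k) * of_nat n + \<zeta>) * c n"
    and ne: "l1 \<noteq> l2" "norm l1 \<le> 1" "norm l2 \<le> 1" and k: "Re k > 1"
  shows "summable (\<lambda>n. norm (c n))"
proof -
  obtain \<rho> where \<rho>: "1 < \<rho>" "\<rho> < Re k" using k dense by blast
  obtain S K where S: "\<And>n. S n \<ge> 0" "\<forall>\<^sub>F n in sequentially. norm (c n) \<le> K * S n"
    "\<forall>\<^sub>F n in sequentially. (real n + 1) * S (Suc n) \<le> (real n + 1 - \<rho>) * S n"
    using second_order_recurrence_growth[OF rec ne \<rho>(2)] by blast
  have "summable S" by (rule raabe_summable[OF S(1) \<rho>(1) S(3)])
  then have "summable (\<lambda>n. K * S n)" by (rule summable_mult)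
  then show ?thesis by (rule summable_comparison_test_ev[rotated]) (use S(2) in simp)
qed

lemma second_order_recurrence_summable_powser:
  fixes c :: "nat \<Rightarrow> complex"
  assumes rec: "\<And>n. of_nat (n+1) * of_nat (n+2) * c (n+2) =
      (l1 + l2) * of_nat (n+1) * (of_nat (n+2) - k) * c (n+1)
      - l1 * l2 * ((of_nat n)\<^sup>2 + (3 - 2*k) * of_nat n + \<zeta>) * c n"
    and ne: "l1 \<noteq> l2" "norm l1 \<le> 1" "norm l2 \<le> 1" and r: "0 \<le> r" "r < 1"
  shows "summable (\<lambda>n. norm (c n) * r ^ n)"
proof -
  define \<rho> where "\<rho> = Re k - 1"
  have \<rho>: "\<rho> < Re k" by (simp add: \<rho>_def)
  obtain S K where S: "\<And>n. S n \<ge> 0" "\<forall>\<^sub>F n in sequentially. norm (c n) \<le> K * S n"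
    "\<forall>\<^sub>F n in sequentially. (real n + 1) * S (Suc n) \<le> (real n + 1 - \<rho>) * S n"
    using second_order_recurrence_growth[OF rec ne \<rho>] by blast
  define T where "T n = S n * r ^ n" for n
  have "summable T" unfolding T_def by (rule raabe_powser_summable[OF S(1,3) r])
  then have "summable (\<lambda>n. K * T n)" by (rule summable_mult)
  moreover have "\<forall>\<^sub>F n in sequentially. norm (norm (c n) * r ^ n) \<le> K * T n"
    using S(2) by eventually_elim (use r in \<open>auto simp: T_def norm_mult mult.assoc[symmetric] intro!: mult_right_mono\<close>)
  ultimately show ?thesis by (rule summable_comparison_test_ev[rotated])
qed

lemma exp_generating_on_subset:
  assumes "exp_generating_on D a f" "D' \<subseteq> D"
  shows "exp_generating_on D' a f"
  using assms interior_mono[OF assms(2)]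
  unfolding exp_generating_on_def continuation_from_0_def
  by (meson continuous_on_subset holomorphic_on_subset subsetD)

lemma exp_generating_on_holomorphic:
  assumes G: "G holomorphic_on D" and D: "open D" "\<And>s. s \<in> D \<Longrightarrow> \<exists>r>norm s. ball 0 r \<subseteq> D"
    and ev: "\<forall>\<^sub>F s in nhds 0. f s = G s" and a: "\<And>n. (deriv ^^ n) G 0 = a n"
  shows "exp_generating_on D a f"
  unfolding exp_generating_on_def continuation_from_0_def
proof (intro exI[of _ G] conjI ballI)
  show "G holomorphic_on interior D" using G D by (simp add: interior_open)
  show "continuous_on D G" using G by (rule holomorphic_on_imp_continuous_on)
  show "\<forall>\<^sub>F s in nhds 0. G s = f s" using ev by (simp add: eq_commute)
  fix s assume "s \<in> D"
  then obtain r where r: "r > norm s" "ball 0 r \<subseteq> D" using D by blast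
  have "(\<lambda>n. (deriv ^^ n) G 0 / fact n * (s - 0) ^ n) sums G s"
    by (rule holomorphic_power_series[of G 0 r]) (use r G in \<open>auto intro: holomorphic_on_subset\<close>)
  then show "(\<lambda>n. a n * (s ^ n / fact n)) sums G s" by (simp add: a)
qed

lemma summable_exp_generating_terms:
  fixes a :: "nat \<Rightarrow> complex"
  assumes "summable (\<lambda>n. norm (a n / fact n) * r ^ n)" "norm s \<le> r"
  shows "summable (\<lambda>n. a n * (s ^ n / fact n))"
  by (rule summable_comparison_test'[OF assms(1), of 0])
     (use assms(2) in \<open>auto simp: norm_mult norm_divide norm_power intro!: divide_right_mono mult_left_mono power_mono\<close>)

lemma exp_generating_on_open:
  assumes D: "open D"
    and a: "\<And>s. s \<in> D \<Longrightarrow> \<exists>r>norm s. summable (\<lambda>n. norm (a n / fact n) * r ^ n)"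
    and ev: "\<forall>\<^sub>F s in nhds 0. (\<lambda>n. a n * (s ^ n / fact n)) sums f s"
  shows "exp_generating_on D a f"
proof -
  define g where "g s = (\<Sum>n. a n * (s ^ n / fact n))" for s
  have g: "(\<lambda>n. a n * (s ^ n / fact n)) sums g s"
    if "summable (\<lambda>n. norm (a n / fact n) * r ^ n)" "norm s \<le> r" for s r
    unfolding g_def using summable_exp_generating_terms[OF that] by (rule summable_sums)
  have "g field_differentiable at s" if s: "s \<in> D" for s
  proof -
    obtain r where r: "r > norm s" "summable (\<lambda>n. norm (a n / fact n) * r ^ n)" using a[OF s] by blast
    have "g holomorphic_on ball 0 r"
      by (rule power_series_holomorphic[where a = "\<lambda>n. a n / fact n"]) (use g[OF r(2)] in simp)
    then show ?thesis using r by (intro holomorphic_on_imp_differentiable_at[of g "ball 0 r"]) auto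
  qed
  then have hol: "g holomorphic_on D" by (auto simp: holomorphic_on_def field_differentiable_at_within)
  show ?thesis
    unfolding exp_generating_on_def continuation_from_0_def
  proof (intro exI[of _ g] conjI ballI)
    show "\<forall>\<^sub>F s in nhds 0. g s = f s"
      using ev by eventually_elim (simp add: g_def sums_iff)
    show "(\<lambda>n. a n * (s ^ n / fact n)) sums g s" if s: "s \<in> D" for s
      using a[OF s] g less_imp_le by blast
  qed (use hol D in \<open>auto intro: holomorphic_on_imp_continuous_on simp: interior_open\<close>)
qed

lemma exp_generating_on_ball:
  assumes a: "\<And>r. 0 \<le> r \<Longrightarrow> r < R \<Longrightarrow> summable (\<lambda>n. norm (a n / fact n) * r ^ n)"
    and ev: "\<forall>\<^sub>F s in nhds 0. (\<lambda>n. a n * (s ^ n / fact n)) sums f s"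
  shows "exp_generating_on (ball 0 R) a f"
proof (rule exp_generating_on_open[OF open_ball _ ev])
  fix s :: complex assume "s \<in> ball 0 R"
  then obtain r where "norm s < r" "r < R" using dense by auto
  moreover have "0 \<le> r" using \<open>norm s < r\<close> norm_ge_zero[of s] by linarith
  ultimately show "\<exists>r>norm s. summable (\<lambda>n. norm (a n / fact n) * r ^ n)" using a by blast
qed

lemma exp_generating_on_cball:
  assumes R: "R > 0" and a: "summable (\<lambda>n. norm (a n / fact n) * R ^ n)"
    and ev: "\<forall>\<^sub>F s in nhds 0. (\<lambda>n. a n * (s ^ n / fact n)) sums f s"
  shows "exp_generating_on (cball 0 R) a f"
proof -
  define g where "g s = (\<Sum>n. a n * (s ^ n / fact n))" for s
  have g: "(\<lambda>n. a n * (s ^ n / fact n)) sums g s" if "s \<in> cball 0 R" for s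
    unfolding g_def using summable_exp_generating_terms[OF a, of s] that by (auto intro: summable_sums)
  have hol: "g holomorphic_on ball 0 R"
    by (rule power_series_holomorphic[where a = "\<lambda>n. a n / fact n"]) (use g in simp)
  have "uniform_limit (cball 0 R) (\<lambda>n s. \<Sum>i<n. a i * (s ^ i / fact i)) g sequentially"
    unfolding g_def
    by (rule Weierstrass_m_test[OF _ a])
       (auto simp: norm_mult norm_divide norm_power intro!: divide_right_mono mult_left_mono power_mono)
  then have "continuous_on (cball 0 R) g"
    by (rule uniform_limit_theorem[rotated]) (auto intro!: always_eventually continuous_intros)
  then show ?thesis
    unfolding exp_generating_on_def continuation_from_0_def
  proof (intro exI[of _ g] conjI ballI)
    show "\<forall>\<^sub>F s in nhds 0. g s = f s"
      using ev by eventually_elim (simp add: g_def sums_iff)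
  qed (use hol g in auto)
qed

lemma higher_deriv_family:
  assumes F: "\<And>n s. s \<in> ball 0 e \<Longrightarrow> (F n has_field_derivative F (Suc n) s) (at s)" and s: "s \<in> ball (0::complex) e"
  shows "(deriv ^^ n) (F 0) s = F n s"
  using s
proof (induction n arbitrary: s)
  case (Suc n)
  have "\<forall>\<^sub>F w in nhds s. (deriv ^^ n) (F 0) w = F n w"
  proof -
    have "\<forall>\<^sub>F w in nhds s. w \<in> ball 0 e" using Suc.prems by (intro eventually_nhds_in_open) auto
    then show ?thesis by eventually_elim (use Suc in auto)
  qed
  then have "deriv ((deriv ^^ n) (F 0)) s = deriv (F n) s" by (rule deriv_cong_ev) simp
  also have "\<dots> = F (Suc n) s" using F[OF Suc.prems] by (rule DERIV_imp_deriv)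
  finally show ?case by simp
qed simp

lemma taylor_family:
  assumes F: "\<And>n s. s \<in> ball 0 e \<Longrightarrow> (F n has_field_derivative F (Suc n) s) (at s)" and s: "s \<in> ball (0::complex) e"
  shows "(\<lambda>n. F n 0 * (s ^ n / fact n)) sums F 0 s"
proof -
  have e: "e > 0" using s by (metis ball_eq_empty empty_iff not_le)
  have "F 0 holomorphic_on ball 0 e"
    unfolding holomorphic_on_def field_differentiable_def using F[of _ 0] has_field_derivative_at_within by blast
  then have "(\<lambda>n. (deriv ^^ n) (F 0) 0 / fact n * (s - 0) ^ n) sums F 0 s"
    by (rule holomorphic_power_series) (use s in auto)
  then show ?thesis using higher_deriv_family[where F = F and e = e and s = 0, OF F] e by (simp add: field_simps)
qed

lemma norm_bound_from_derivative_on_ray: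
  fixes H h :: "complex \<Rightarrow> complex"
  assumes H: "\<And>t. 0 \<le> t \<Longrightarrow> t \<le> 1 \<Longrightarrow> (H has_field_derivative h (of_real t * z)) (at (of_real t * z))"
    and bd: "\<And>t. 0 \<le> t \<Longrightarrow> t \<le> 1 \<Longrightarrow> norm (h (of_real t * z)) \<le> B * (t * norm z) ^ n"
    and 0: "H 0 = 0"
  shows "norm (H z) \<le> B * norm z ^ Suc n / real (Suc n)"
proof -
  define f where "f t = H (of_real t * z)" for t :: real
  define \<phi> where "\<phi> t = B * norm z ^ Suc n * t ^ Suc n / real (Suc n)" for t :: real
  have df: "(f has_vector_derivative h (of_real t * z) * z) (at t)" if "0 \<le> t" "t \<le> 1" for t
  proof -
    have "((\<lambda>t. of_real t * z) has_vector_derivative z) (at t)"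
      by (auto intro!: derivative_eq_intros)
    from field_vector_diff_chain_at[OF this H[OF that]]
    moreover have "f = H \<circ> (\<lambda>t. of_real t * z)" by (simp add: f_def o_def fun_eq_iff)
    ultimately show ?thesis by (simp add: mult.commute)
  qed
  have "norm (f 1 - f 0) \<le> \<phi> 1 - \<phi> 0"
  proof (rule differentiable_bound_general[where f' = "\<lambda>t. h (of_real t * z) * z" and \<phi>' = "\<lambda>t. B * norm z ^ Suc n * t ^ n"])
    show "continuous_on {0..1} f"
      using df has_vector_derivative_continuous by (intro continuous_at_imp_continuous_on) fastforce
    show "continuous_on {0..1} \<phi>" unfolding \<phi>_def by (intro continuous_intros) auto
    show "(\<phi> has_vector_derivative B * norm z ^ Suc n * t ^ n) (at t)" for t
      unfolding \<phi>_def has_real_derivative_iff_has_vector_derivative[symmetric]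
      by (rule derivative_eq_intros refl | simp del: of_nat_Suc power_Suc)+
    show "norm (h (of_real t * z) * z) \<le> B * norm z ^ Suc n * t ^ n" if "0 < t" "t < 1" for t
      using mult_right_mono[OF bd[of t], of "norm z"] that by (simp add: norm_mult power_mult_distrib mult_ac)
  qed (use df in auto)
  then show ?thesis by (simp add: f_def \<phi>_def 0 del: of_nat_Suc power_Suc)
qed

lemma linear_system_iterate_bound:
  fixes A :: "'i::finite \<Rightarrow> 'i \<Rightarrow> complex \<Rightarrow> complex" and u :: "nat \<Rightarrow> 'i \<Rightarrow> complex \<Rightarrow> complex"
  assumes K: "\<And>t w. w \<in> K \<Longrightarrow> 0 \<le> t \<Longrightarrow> t \<le> 1 \<Longrightarrow> complex_of_real t * w \<in> K"
    and M: "\<And>w i. w \<in> K \<Longrightarrow> (\<Sum>j\<in>UNIV. norm (A i j w)) \<le> M"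
    and u: "\<And>n i w. w \<in> K \<Longrightarrow> (u (Suc n) i has_field_derivative (\<Sum>j\<in>UNIV. A i j w * u n j w)) (at w)"
    and u0: "\<And>n i. u (Suc n) i 0 = 0" and C: "\<And>i w. w \<in> K \<Longrightarrow> norm (u 0 i w) \<le> C"
    and z: "z \<in> K"
  shows "norm (u n i z) \<le> C * (M * norm z) ^ n / fact n"
  using z
proof (induction n arbitrary: i z)
  case 0
  then show ?case using C by simp
next
  case (Suc n)
  have M0: "M \<ge> 0" using order_trans[OF sum_nonneg M[OF Suc.prems]] by force
  have "norm (u (Suc n) i z) \<le> (C * M ^ Suc n / fact n) * norm z ^ Suc n / real (Suc n)"
  proof (rule norm_bound_from_derivative_on_ray[where h = "\<lambda>w. \<Sum>j\<in>UNIV. A i j w * u n j w"])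
    fix t :: real assume t: "0 \<le> t" "t \<le> 1"
    define w where "w = of_real t * z"
    have w: "w \<in> K" using K t Suc.prems by (simp add: w_def)
    have nw: "norm w = t * norm z" using t by (simp add: w_def norm_mult)
    show "(u (Suc n) i has_field_derivative (\<Sum>j\<in>UNIV. A i j (of_real t * z) * u n j (of_real t * z))) (at (of_real t * z))"
      using u[OF w] by (simp add: w_def)
    have "norm (\<Sum>j\<in>UNIV. A i j w * u n j w) \<le> (\<Sum>j\<in>UNIV. norm (A i j w) * (C * (M * norm w) ^ n / fact n))"
      by (intro sum_norm_le, simp only: norm_mult[of "A _ _ _"], intro mult_left_mono Suc.IH w norm_ge_zero)
    also have "\<dots> = (\<Sum>j\<in>UNIV. norm (A i j w)) * (C * (M * norm w) ^ n / fact n)" by (simp only: sum_distrib_right)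
    also have "\<dots> \<le> M * (C * (M * norm w) ^ n / fact n)"
      using order_trans[OF norm_ge_zero Suc.IH[OF w, of i]] by (intro mult_right_mono M w) auto
    also have "\<dots> = (C * M ^ Suc n / fact n) * (t * norm z) ^ n"
      by (simp add: nw power_mult_distrib mult_ac)
    finally show "norm (\<Sum>j\<in>UNIV. A i j (of_real t * z) * u n j (of_real t * z)) \<le> (C * M ^ Suc n / fact n) * (t * norm z) ^ n"
      by (simp add: w_def)
  qed (rule u0)
  also have "\<dots> = C * (M * norm z) ^ Suc n / fact (Suc n)"
    by (simp add: power_mult_distrib mult_ac)
  finally show ?case .
qed

lemma linear_system_unique:
  fixes A :: "'i::finite \<Rightarrow> 'i \<Rightarrow> complex \<Rightarrow> complex"
  assumes A: "\<And>i j. continuous_on S (A i j)" and S: "\<And>z. z \<in> S \<Longrightarrow> closed_segment 0 z \<subseteq> S"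
    and h: "\<And>i w. w \<in> S \<Longrightarrow> (h i has_field_derivative (\<Sum>j\<in>UNIV. A i j w * h j w)) (at w)"
    and h0: "\<And>i. h i 0 = 0" and z: "z \<in> S"
  shows "h i z = 0"
proof -
  define K where "K = closed_segment 0 z"
  have KS: "K \<subseteq> S" using S z by (simp add: K_def)
  have K: "of_real t * w \<in> K" if "w \<in> K" "0 \<le> t" "t \<le> 1" for t w
  proof -
    obtain s where s: "0 \<le> s" "s \<le> 1" "w = of_real s * z"
      using \<open>w \<in> K\<close> by (auto simp: K_def in_segment scaleR_conv_of_real)
    have "0 \<le> t * s" "t * s \<le> 1" using s that by (auto intro: mult_le_one)
    then show ?thesis using s by (auto simp: K_def in_segment scaleR_conv_of_real intro!: exI[of _ "t * s"])
  qed
  have cpt: "compact K" by (simp add: K_def)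
  have "continuous_on K (\<lambda>w. \<Sum>i\<in>UNIV. \<Sum>j\<in>UNIV. norm (A i j w))"
    using A KS by (intro continuous_intros) (auto intro: continuous_on_subset)
  then have "bounded ((\<lambda>w. \<Sum>i\<in>UNIV. \<Sum>j\<in>UNIV. norm (A i j w)) ` K)"
    by (intro compact_imp_bounded compact_continuous_image cpt)
  then obtain M where M: "\<And>w. w \<in> K \<Longrightarrow> (\<Sum>i\<in>UNIV. \<Sum>j\<in>UNIV. norm (A i j w)) \<le> M"
    unfolding bounded_iff by (metis abs_le_D1 imageI real_norm_def)
  have M': "(\<Sum>j\<in>UNIV. norm (A i j w)) \<le> M" if "w \<in> K" for i w
    by (rule order_trans[OF member_le_sum M[OF that]]) (auto intro: sum_nonneg)
  have "continuous_on K (\<lambda>w. \<Sum>i\<in>UNIV. norm (h i w))"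
    using h KS by (intro continuous_intros continuous_at_imp_continuous_on) (auto intro: DERIV_isCont)
  then have "bounded ((\<lambda>w. \<Sum>i\<in>UNIV. norm (h i w)) ` K)"
    by (intro compact_imp_bounded compact_continuous_image cpt)
  then obtain C where C: "\<And>w. w \<in> K \<Longrightarrow> (\<Sum>i\<in>UNIV. norm (h i w)) \<le> C"
    unfolding bounded_iff by (metis abs_le_D1 imageI real_norm_def)
  have C': "norm (h i w) \<le> C" if "w \<in> K" for i w
    by (rule order_trans[OF member_le_sum C[OF that]]) auto
  have "norm (h i z) \<le> C * (M * norm z) ^ n / fact n" for n
    by (rule linear_system_iterate_bound[of K A M "\<lambda>_. h"]) (use K M' h h0 C' KS in \<open>auto simp: K_def\<close>)
  moreover have "(\<lambda>n. C * (M * norm z) ^ n / fact n) \<longlonglongrightarrow> C * 0"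
    unfolding times_divide_eq_right[symmetric]
    by (intro tendsto_mult tendsto_const summable_LIMSEQ_zero)
       (use summable_exp[of "M * norm z"] in \<open>simp add: field_simps\<close>)
  ultimately have "norm (h i z) \<le> C * 0" by (intro LIMSEQ_le_const) auto
  then show ?thesis by simp
qed

text \<open>Picard iteration; the \<open>n\<close>-th correction is \<open>O(M\<^sup>n / n!)\<close> on compact sets that are star-shaped about 0.\<close>

lemma linear_system_solution_exists:
  fixes A :: "'i::finite \<Rightarrow> 'i \<Rightarrow> complex \<Rightarrow> complex" and p :: "'i \<Rightarrow> complex"
  assumes A: "\<And>i j. A i j holomorphic_on S" and S: "\<And>z. z \<in> S \<Longrightarrow> closed_segment 0 z \<subseteq> S"
    and op: "open S" and 0: "0 \<in> S"
  shows "\<exists>h. (\<forall>i. h i 0 = p i) \<and>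
             (\<forall>i. \<forall>w\<in>S. (h i has_field_derivative (\<Sum>j\<in>UNIV. A i j w * h j w)) (at w))"
proof -
  define prim where "prim f = (SOME F. F 0 = 0 \<and> (\<forall>z\<in>S. (F has_field_derivative f z) (at z)))" for f
  have prim: "prim f 0 = 0 \<and> (\<forall>z\<in>S. (prim f has_field_derivative f z) (at z))" if f: "f holomorphic_on S" for f
  proof -
    have "starlike S" using S 0 by (auto simp: starlike_def)
    then have "\<exists>F. \<forall>z\<in>S. (F has_field_derivative f z) (at z)"
      using f op by (intro holomorphic_starlike_primitive[of S f "{}"])
        (auto intro: holomorphic_on_imp_continuous_on holomorphic_on_imp_differentiable_at)
    then obtain F where "\<forall>z\<in>S. (F has_field_derivative f z) (at z)" ..
    then have "F 0 - F 0 = 0 \<and> (\<forall>z\<in>S. ((\<lambda>z. F z - F 0) has_field_derivative f z) (at z))"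
      by (auto intro!: derivative_eq_intros)
    then show ?thesis
      unfolding prim_def by (rule someI[of "\<lambda>F. F 0 = 0 \<and> (\<forall>z\<in>S. (F has_field_derivative f z) (at z))"])
  qed
  define u where "u = rec_nat (\<lambda>i (w::complex). p i) (\<lambda>n v i. prim (\<lambda>w. \<Sum>j\<in>UNIV. A i j w * v j w))"
  have u_0: "u 0 = (\<lambda>i w. p i)" and u_Suc: "u (Suc n) i = prim (\<lambda>w. \<Sum>j\<in>UNIV. A i j w * u n j w)" for n i
    by (simp_all add: u_def)
  have hol: "u n i holomorphic_on S" for n i
  proof (induction n arbitrary: i)
    case (Suc n)
    have "(\<lambda>w. \<Sum>j\<in>UNIV. A i j w * u n j w) holomorphic_on S" by (intro holomorphic_intros A Suc)
    from prim[OF this] have "\<forall>z\<in>S. (u (Suc n) i has_field_derivative (\<Sum>j\<in>UNIV. A i j z * u n j z)) (at z)"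
      by (simp add: u_Suc)
    then show ?case
      unfolding holomorphic_on_def field_differentiable_def using has_field_derivative_at_within by blast
  qed (simp add: u_0)
  have hol': "(\<lambda>w. \<Sum>j\<in>UNIV. A i j w * u n j w) holomorphic_on S" for n i
    by (intro holomorphic_intros A hol)
  have du: "(u (Suc n) i has_field_derivative (\<Sum>j\<in>UNIV. A i j z * u n j z)) (at z)" if "z \<in> S" for n i z
    using prim[OF hol'] that unfolding u_Suc by blast
  have u0: "u (Suc n) i 0 = 0" for n i
    using prim[OF hol'] unfolding u_Suc by blast
  define h where "h i z = (\<Sum>n. u n i z)" for i z
  have loc: "\<exists>e>0. cball z e \<subseteq> S \<and> (\<forall>i. uniform_limit (cball z e) (\<lambda>n w. \<Sum>k<n. u k i w) (h i) sequentially)"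
    if z: "z \<in> S" for z
  proof -
    obtain e where e: "e > 0" "cball z e \<subseteq> S" using op z open_contains_cball by blast
    define K where "K = (\<lambda>(t, w). complex_of_real t * w) ` ({0..1} \<times> cball z e)"
    have KS: "K \<subseteq> S"
    proof
      fix v assume "v \<in> K"
      then obtain t w where tw: "0 \<le> t" "t \<le> 1" "w \<in> cball z e" "v = of_real t * w" by (auto simp: K_def)
      then have "v \<in> closed_segment 0 w" by (auto simp: in_segment scaleR_conv_of_real)
      then show "v \<in> S" using S e tw by blast
    qed
    have sub: "cball z e \<subseteq> K" by (force simp: K_def image_iff intro: bexI[of _ "(1, _)"])
    have K: "of_real t * w \<in> K" if "w \<in> K" "0 \<le> t" "t \<le> 1" for t w
    proof -
      obtain s y where s: "0 \<le> s" "s \<le> 1" "y \<in> cball z e" "w = of_real s * y" using \<open>w \<in> K\<close> by (auto simp: K_def)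
      have "0 \<le> t * s" "t * s \<le> 1" using s that by (auto intro: mult_le_one)
      then have "(t * s, y) \<in> {0..1} \<times> cball z e" using s by auto
      then show ?thesis unfolding K_def by (rule rev_image_eqI) (use s in simp)
    qed
    have cpt: "compact K" unfolding K_def
      by (intro compact_continuous_image compact_Times compact_cball compact_Icc)
         (auto simp: case_prod_unfold intro!: continuous_intros)
    have "continuous_on K (\<lambda>w. \<Sum>i\<in>UNIV. \<Sum>j\<in>UNIV. norm (A i j w))"
      by (intro continuous_intros holomorphic_on_imp_continuous_on holomorphic_on_subset[OF A KS])
    then have "bounded ((\<lambda>w. \<Sum>i\<in>UNIV. \<Sum>j\<in>UNIV. norm (A i j w)) ` K)"
      by (intro compact_imp_bounded compact_continuous_image cpt)
    then obtain M where M: "\<And>w. w \<in> K \<Longrightarrow> (\<Sum>i\<in>UNIV. \<Sum>j\<in>UNIV. norm (A i j w)) \<le> M"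
      unfolding bounded_iff by (metis abs_le_D1 imageI real_norm_def)
    have M': "(\<Sum>j\<in>UNIV. norm (A i j w)) \<le> M" if "w \<in> K" for i w
      by (rule order_trans[OF member_le_sum M[OF that]]) (auto intro: sum_nonneg)
    define C where "C = (\<Sum>i\<in>UNIV. norm (p i))"
    have C: "norm (u 0 i w) \<le> C" for i w unfolding u_0 C_def by (rule member_le_sum) auto
    have "bounded K" using cpt by (rule compact_imp_bounded)
    then obtain R where R: "\<And>w. w \<in> K \<Longrightarrow> norm w \<le> R" unfolding bounded_iff by blast
    have M0: "M \<ge> 0"
      using z sub e M[of z] by (intro order_trans[OF _ M[of z]]) (auto intro!: sum_nonneg)
    have C0: "C \<ge> 0" by (simp add: C_def sum_nonneg)
    have bd: "norm (u n i w) \<le> C * ((M * R) ^ n / fact n)" if "w \<in> K" for n i w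
    proof -
      have "norm (u n i w) \<le> C * (M * norm w) ^ n / fact n"
        by (rule linear_system_iterate_bound[of K A M]) (use K M' du u0 C that KS in auto)
      also have "\<dots> \<le> C * (M * R) ^ n / fact n"
        using M0 C0 R[OF that] by (intro divide_right_mono mult_left_mono power_mono) auto
      finally show ?thesis by simp
    qed
    have "summable (\<lambda>n. C * ((M * R) ^ n / fact n))"
      using summable_exp[of "M * R"] by (intro summable_mult) (simp add: field_simps)
    then have "uniform_limit (cball z e) (\<lambda>n w. \<Sum>k<n. u k i w) (h i) sequentially" for i
      unfolding h_def by (rule Weierstrass_m_test[rotated]) (use bd sub in blast)
    then show ?thesis using e by blast
  qed
  have lim: "(\<lambda>n. \<Sum>k<n. u k i z) \<longlonglongrightarrow> h i z" if z: "z \<in> S" for i z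
  proof -
    obtain e where e: "e > 0" "uniform_limit (cball z e) (\<lambda>n w. \<Sum>k<n. u k i w) (h i) sequentially"
      using loc[OF z] by blast
    show ?thesis by (rule tendsto_uniform_limitI[OF e(2)]) (use e(1) in simp)
  qed
  have "(h i has_field_derivative (\<Sum>j\<in>UNIV. A i j w * h j w)) (at w)" if w: "w \<in> S" for i w
  proof -
    define d where "d n z = (case n of 0 \<Rightarrow> 0 | Suc m \<Rightarrow> \<Sum>j\<in>UNIV. A i j z * (\<Sum>k<m. u k j z))" for n z
    have dd: "((\<lambda>w. \<Sum>k<Suc m. u k i w) has_field_derivative d (Suc m) z) (at z)" if "z \<in> S" for m z
    proof (induction m)
      case (Suc m)
      have "d (Suc (Suc m)) z = d (Suc m) z + (\<Sum>j\<in>UNIV. A i j z * u m j z)"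
        by (simp add: d_def sum.distrib distrib_left)
      then show ?case using DERIV_add[OF Suc du[OF that, of m i]] by simp
    qed (simp add: d_def u_0)
    have dd': "((\<lambda>w. \<Sum>k<n. u k i w) has_field_derivative d n z) (at z)" if "z \<in> S" for n z
      using dd[OF that] by (cases n) (simp_all add: d_def)
    have ul: "\<exists>e. 0 < e \<and> cball x e \<subseteq> S \<and> uniform_limit (cball x e) (\<lambda>n w. \<Sum>k<n. u k i w) (h i) sequentially"
      if "x \<in> S" for x using loc[OF that] by meson
    obtain g' where g': "\<And>z. z \<in> S \<Longrightarrow> (h i has_field_derivative g' z) (at z) \<and> (\<lambda>n. d n z) \<longlonglongrightarrow> g' z"
      using has_complex_derivative_uniform_sequence[OF op dd' ul] by meson
    have "(\<lambda>m. d (Suc m) w) \<longlonglongrightarrow> (\<Sum>j\<in>UNIV. A i j w * h j w)"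
      unfolding d_def nat.case by (intro tendsto_intros lim w)
    moreover have "(\<lambda>m. d (Suc m) w) \<longlonglongrightarrow> g' w" by (rule LIMSEQ_Suc) (use g'[OF w] in blast)
    ultimately have "g' w = (\<Sum>j\<in>UNIV. A i j w * h j w)" by (rule LIMSEQ_unique[rotated])
    then show ?thesis using g'[OF w] by simp
  qed
  moreover have "h i 0 = p i" for i
  proof -
    have "u n i 0 = (if n = 0 then p i else 0)" for n using u0 by (cases n) (simp_all add: u_0)
    then show ?thesis using sums_unique[OF sums_single[of 0 "\<lambda>_. p i"]] by (simp add: h_def)
  qed
  ultimately show ?thesis by blast
qed

definition legendre_coeff :: "complex \<Rightarrow> complex \<Rightarrow> nat \<Rightarrow> complex" where
  "legendre_coeff \<nu> c k = pochhammer (- \<nu>) k * pochhammer (\<nu> + 1) k * rGamma (c + of_nat k) / fact k"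

definition legendre_fps :: "complex \<Rightarrow> complex \<Rightarrow> complex fps" where
  "legendre_fps \<nu> c = Abs_fps (legendre_coeff \<nu> c)"

lemma eval_legendre_fps: "eval_fps (legendre_fps \<nu> c) w = hypergeo_reg (- \<nu>) (\<nu> + 1) c w"
  by (simp add: eval_fps_def legendre_fps_def hypergeo_reg_def legendre_coeff_def)

lemma rGamma_plus1': "rGamma z = z * rGamma (z + 1 :: complex)"
  by (simp add: rGamma_plus1)

lemma legendre_coeff_Suc:
  "of_nat (Suc k) * (c + of_nat k) * legendre_coeff \<nu> c (Suc k) =
     (of_nat k - \<nu>) * (of_nat k + \<nu> + 1) * legendre_coeff \<nu> c k"
proof -
  have "rGamma (c + of_nat k) = (c + of_nat k) * rGamma (c + of_nat (Suc k))"
    using rGamma_plus1'[of "c + of_nat k"] by (simp add: add_ac)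
  then show ?thesis
    by (simp add: legendre_coeff_def pochhammer_Suc field_simps del: of_nat_Suc)
qed

lemma legendre_coeff_decay:
  assumes \<rho>: "\<rho> < Re c"
  shows "\<forall>\<^sub>F k in sequentially. (real k + 1) * norm (legendre_coeff \<nu> c (Suc k)) \<le> (real k + 1 - \<rho>) * norm (legendre_coeff \<nu> c k)"
proof -
  define e where "e = (Re c - \<rho>) / 3"
  have e: "e > 0" using \<rho> by (simp add: e_def)
  have ec: "Re c = \<rho> + 3 * e" by (simp add: e_def field_simps)
  have "\<forall>\<^sub>F k in sequentially. norm (of_nat k + (- \<nu>)) \<le> real k + (- Re \<nu> + e)"
    "\<forall>\<^sub>F k in sequentially. norm (of_nat k + (\<nu> + 1)) \<le> real k + (Re \<nu> + 1 + e)"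
    by (rule eventually_norm_of_nat_add_le, use e in simp)+
  moreover have "\<forall>\<^sub>F k in sequentially. (real k + (- Re \<nu> + e)) * (real k + (Re \<nu> + 1 + e)) \<le> (real k + 1 - \<rho>) * (real k + Re c)"
  proof -
    have "\<forall>\<^sub>F k in sequentially. (e - Re \<nu>) * (Re \<nu> + 1 + e) - (1 - \<rho>) * Re c \<le> e * real k"
      using e by real_asymp
    then show ?thesis by eventually_elim (simp add: ec algebra_simps)
  qed
  moreover have "\<forall>\<^sub>F k in sequentially. real k + Re c > 0" "\<forall>\<^sub>F k in sequentially. real k + (- Re \<nu> + e) > 0" 
    "\<forall>\<^sub>F k in sequentially. real k + 1 - \<rho> > 0"
    by real_asymp+
  ultimately show ?thesis
  proof eventually_elim
    case (elim k)
    define h where "h = legendre_coeff \<nu> c"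
    have n: "norm (c + of_nat k) \<ge> real k + Re c" using complex_Re_le_cmod[of "c + of_nat k"] by simp
    have "(real k + Re c) * ((real k + 1) * norm (h (Suc k))) \<le> norm (c + of_nat k) * ((real k + 1) * norm (h (Suc k)))"
      using n by (intro mult_right_mono) auto
    also have "\<dots> = norm (of_nat (Suc k) * (c + of_nat k) * h (Suc k))"
      by (simp only: norm_mult norm_of_nat) (simp add: mult_ac add_ac)
    also have "\<dots> = norm (of_nat k + (- \<nu>)) * norm (of_nat k + (\<nu> + 1)) * norm (h k)"
      unfolding h_def legendre_coeff_Suc by (simp add: norm_mult add_ac)
    also have "\<dots> \<le> (real k + (- Re \<nu> + e)) * (real k + (Re \<nu> + 1 + e)) * norm (h k)"
      using elim by (intro mult_right_mono mult_mono) auto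
    also have "\<dots> \<le> (real k + 1 - \<rho>) * (real k + Re c) * norm (h k)"
      using elim by (intro mult_right_mono) auto
    finally have "(real k + Re c) * ((real k + 1) * norm (h (Suc k))) \<le> (real k + Re c) * ((real k + 1 - \<rho>) * norm (h k))"
      by (simp add: mult_ac)
    then show ?case using elim by (simp add: h_def)
  qed
qed

lemma legendre_coeff_summable:
  assumes "Re c > 1"
  shows "summable (\<lambda>k. norm (legendre_coeff \<nu> c k))"
proof -
  obtain \<rho> where "1 < \<rho>" "\<rho> < Re c" using assms dense by blast
  then show ?thesis by (intro raabe_summable[of _ \<rho>] legendre_coeff_decay) auto
qed

lemma legendre_fps_conv_radius: "fps_conv_radius (legendre_fps \<nu> c) \<ge> 1"
  unfolding fps_conv_radius_def
proof (rule conv_radius_geI_ex)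
  fix r :: real assume r: "0 < r" "ereal r < 1"
  have "summable (\<lambda>k. norm (legendre_coeff \<nu> c k) * r ^ k)"
    by (rule raabe_powser_summable[OF _ legendre_coeff_decay[of "Re c - 1"]]) (use r in auto)
  then have "summable (\<lambda>k. legendre_coeff \<nu> c k * of_real r ^ k)"
    by (intro summable_norm_cancel[where f = "\<lambda>k. legendre_coeff \<nu> c k * of_real r ^ k"])
       (use r in \<open>simp add: norm_mult norm_power\<close>)
  then show "\<exists>z. norm z = r \<and> summable (\<lambda>n. fps_nth (legendre_fps \<nu> c) n * z ^ n)"
    using r by (intro exI[of _ "of_real r"]) (simp add: legendre_fps_def)
qed

lemma legendre_fps_lower_c:
  "fps_X * fps_deriv (legendre_fps \<nu> c) + fps_const (c - 1) * legendre_fps \<nu> c = legendre_fps \<nu> (c - 1)"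
proof (rule fps_ext)
  fix k
  have nth: "fps_nth (fps_X * fps_deriv F) k = of_nat k * fps_nth F k" for F :: "complex fps"
    by (cases k) simp_all
  have g: "rGamma (c - 1 + of_nat k) = (c - 1 + of_nat k) * rGamma (c + of_nat k)"
    using rGamma_plus1'[of "c - 1 + of_nat k"] by (simp add: algebra_simps)
  show "fps_nth (fps_X * fps_deriv (legendre_fps \<nu> c) + fps_const (c - 1) * legendre_fps \<nu> c) k = fps_nth (legendre_fps \<nu> (c - 1)) k"
    by (simp add: legendre_fps_def legendre_coeff_def nth g) (simp add: algebra_simps add_divide_distrib diff_divide_distrib)
qed

lemma legendre_fps_degree_relation:
  "fps_const 2 * fps_X * (1 - fps_X) * fps_deriv (legendre_fps \<nu> (1 + \<mu>)) =
     fps_const (\<nu> - \<mu>) * (legendre_fps \<nu> (1 + \<mu>) - legendre_fps (\<nu> - 1) (1 + \<mu>))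
     - fps_const (2 * \<nu>) * fps_X * legendre_fps \<nu> (1 + \<mu>)"
proof (rule fps_ext)
  fix k
  define h where "h = legendre_coeff \<nu> (1 + \<mu>)"
  define g where "g = legendre_coeff (\<nu> - 1) (1 + \<mu>)"
  have main: "2 * (of_nat (Suc j) * h (Suc j) - of_nat j * h j) = (\<nu> - \<mu>) * (h (Suc j) - g (Suc j)) - 2 * \<nu> * h j" for j
  proof -
    define X where "X = pochhammer (- \<nu>) j"
    define Y where "Y = pochhammer (\<nu> + 1) j"
    define G where "G = rGamma (1 + \<mu> + of_nat (Suc j)) / fact j"
    define t where "t = (of_nat j :: complex)"
    have t: "of_nat (Suc j) = t + 1" "t + 1 \<noteq> 0"
      using of_nat_neq_0[of j, where 'a=complex] by (simp_all add: t_def add_ac)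
    have f: "fact (Suc j) = (t + 1) * (fact j :: complex)" by (simp add: t_def add_ac)
    have "rGamma (1 + \<mu> + of_nat j) = (\<mu> + t + 1) * rGamma (1 + \<mu> + of_nat (Suc j))"
      using rGamma_plus1'[of "1 + \<mu> + of_nat j"] by (simp add: t_def add_ac)
    then have hj: "h j = X * Y * (\<mu> + t + 1) * G"
      by (simp add: h_def legendre_coeff_def X_def Y_def G_def)
    have hS: "h (Suc j) = X * Y * (t - \<nu>) * (\<nu> + 1 + t) * G / (t + 1)"
      unfolding h_def legendre_coeff_def f by (simp add: X_def Y_def G_def t_def pochhammer_Suc mult_ac)
    have p1: "- \<nu> * pochhammer (1 - \<nu>) (Suc j) = X * (t - \<nu>) * (t + 1 - \<nu>)"
      using pochhammer_rec[of "- \<nu>" "Suc j"] by (simp add: X_def t_def pochhammer_Suc algebra_simps)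
    have p2: "pochhammer \<nu> (Suc j) = \<nu> * Y"
      using pochhammer_rec[of \<nu> j] by (simp add: Y_def)
    have "g (Suc j) = pochhammer (1 - \<nu>) (Suc j) * pochhammer \<nu> (Suc j) * G / (t + 1)"
      unfolding g_def legendre_coeff_def f by (simp add: G_def)
    also have "\<dots> = - ((- \<nu> * pochhammer (1 - \<nu>) (Suc j)) * Y * G / (t + 1))" by (simp add: p2 mult_ac)
    also have "\<dots> = - (X * Y * (t - \<nu>) * (t + 1 - \<nu>) * G / (t + 1))" unfolding p1 by (simp add: mult_ac)
    finally have gS: "g (Suc j) = - (X * Y * (t - \<nu>) * (t + 1 - \<nu>) * G / (t + 1))" .
    define W where "W = X * Y * G / (t + 1)"
    have W: "h j = (\<mu> + t + 1) * (t + 1) * W" "h (Suc j) = (t - \<nu>) * (\<nu> + 1 + t) * W"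
       "g (Suc j) = - ((t - \<nu>) * (t + 1 - \<nu>) * W)"
      using t by (simp_all add: hj hS gS W_def)
    show ?thesis unfolding W t t_def[symmetric] by (simp add: algebra_simps)
  qed
  have "h 0 = g 0" by (simp add: h_def g_def legendre_coeff_def)
  then show "fps_nth (fps_const 2 * fps_X * (1 - fps_X) * fps_deriv (legendre_fps \<nu> (1 + \<mu>))) k =
     fps_nth (fps_const (\<nu> - \<mu>) * (legendre_fps \<nu> (1 + \<mu>) - legendre_fps (\<nu> - 1) (1 + \<mu>))
     - fps_const (2 * \<nu>) * fps_X * legendre_fps \<nu> (1 + \<mu>)) k"
  proof (cases k)
    case 0
    then show ?thesis using \<open>h 0 = g 0\<close> by (simp add: legendre_fps_def h_def g_def mult.assoc)
  next
    case (Suc j)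
    then show ?thesis
      using main[of j]
      by (cases j) (simp_all add: legendre_fps_def h_def g_def mult.assoc left_diff_distrib right_diff_distrib
          fps_X_mult_nth del: of_nat_Suc)
  qed
qed

lemma legendre_fps_order_relation:
  "(1 - fps_X) * legendre_fps \<nu> (c - 2) - fps_const (c - 2) * (1 - fps_const 2 * fps_X) * legendre_fps \<nu> (c - 1)
     + fps_const ((\<nu> + c - 1) * (\<nu> - c + 2)) * fps_X * legendre_fps \<nu> c = 0"
proof (rule fps_ext)
  fix k
  define h where "h m = legendre_coeff \<nu> (c - m)" for m
  have z: "h 2 0 = (c - 2) * h 1 0"
    using rGamma_plus1'[of "c - 2"] by (simp add: h_def legendre_coeff_def)
  have main: "h 2 (Suc j) - h 2 j - (c - 2) * (h 1 (Suc j) - 2 * h 1 j) + (\<nu> + c - 1) * (\<nu> - c + 2) * h 0 j = 0" for j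
  proof -
    define G where "G = pochhammer (- \<nu>) j * pochhammer (\<nu> + 1) j * rGamma (c + of_nat j) / fact (Suc j)"
    define t where "t = (of_nat j :: complex)"
    have f: "fact (Suc j) = (t + 1) * (fact j :: complex)" by (simp add: t_def add_ac)
    have t: "t + 1 \<noteq> 0"
      using of_nat_neq_0[of j, where 'a=complex] by (simp_all add: t_def add_ac)
    have g1: "rGamma (c - 1 + of_nat j) = (c - 1 + t) * rGamma (c + of_nat j)"
      using rGamma_plus1'[of "c - 1 + of_nat j"] by (simp add: t_def algebra_simps)
    have g2: "rGamma (c - 2 + of_nat j) = (c - 2 + t) * (c - 1 + t) * rGamma (c + of_nat j)"
    proof -
      have eq: "c - 2 + of_nat j + 1 = c - 1 + of_nat j" by simp
      show ?thesis using rGamma_plus1'[of "c - 2 + of_nat j"] unfolding eq g1 by (simp add: t_def)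
    qed
    have g1': "rGamma (c - 1 + of_nat (Suc j)) = rGamma (c + of_nat j)"
     and g2': "rGamma (c - 2 + of_nat (Suc j)) = (c - 1 + t) * rGamma (c + of_nat j)"
      using g1 by (simp_all add: algebra_simps)
    have "h 0 j = (t + 1) * G" "h 1 j = (c - 1 + t) * (t + 1) * G" "h 2 j = (c - 2 + t) * (c - 1 + t) * (t + 1) * G"
      unfolding h_def legendre_coeff_def g1 g2 G_def f using t by simp_all
    moreover have "h 1 (Suc j) = (t - \<nu>) * (t + \<nu> + 1) * G" "h 2 (Suc j) = (c - 1 + t) * (t - \<nu>) * (t + \<nu> + 1) * G"
      unfolding h_def legendre_coeff_def g1' g2' G_def
      by (simp_all add: t_def pochhammer_Suc mult_ac add_ac)
    ultimately show ?thesis by (simp only:) (simp add: algebra_simps)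
  qed
  show "fps_nth ((1 - fps_X) * legendre_fps \<nu> (c - 2) - fps_const (c - 2) * (1 - fps_const 2 * fps_X) * legendre_fps \<nu> (c - 1)
     + fps_const ((\<nu> + c - 1) * (\<nu> - c + 2)) * fps_X * legendre_fps \<nu> c) k = fps_nth 0 k"
    using main[of "k - 1"] z
    by (cases k) (simp_all add: legendre_fps_def h_def mult.assoc left_diff_distrib right_diff_distrib
          fps_X_mult_nth del: of_nat_Suc)
qed

abbreviation legendre_hyp :: "complex \<Rightarrow> complex \<Rightarrow> complex \<Rightarrow> complex" where
  "legendre_hyp \<nu> c w \<equiv> hypergeo_reg (- \<nu>) (\<nu> + 1) c w"

lemma legendre_hyp_reflect: "legendre_hyp (- \<nu> - 1) c w = legendre_hyp \<nu> c w"
  by (simp add: hypergeo_reg_def mult_ac add.commute)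

lemma legendre_fps_radius:
  assumes "norm w < 1"
  shows "ereal (norm w) < fps_conv_radius (legendre_fps \<nu> c)"
    "ereal (norm w) < fps_conv_radius (fps_deriv (legendre_fps \<nu> c))"
proof -
  have "ereal (norm w) < 1" using assms by simp
  also note legendre_fps_conv_radius[of \<nu> c]
  finally show "ereal (norm w) < fps_conv_radius (legendre_fps \<nu> c)" .
  also note fps_conv_radius_deriv[of "legendre_fps \<nu> c"]
  finally show "ereal (norm w) < fps_conv_radius (fps_deriv (legendre_fps \<nu> c))" .
qed

lemma legendre_hyp_deriv:
  assumes w: "norm w < 1"
  shows "\<exists>D. (legendre_hyp \<nu> c has_field_derivative D) (at w) \<and>
    w * D + (c - 1) * legendre_hyp \<nu> c w = legendre_hyp \<nu> (c - 1) w \<and>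
    2 * w * (1 - w) * D = (\<nu> - (c - 1)) * (legendre_hyp \<nu> c w - legendre_hyp (\<nu> - 1) c w) - 2 * \<nu> * w * legendre_hyp \<nu> c w"
proof (intro exI conjI)
  note r = legendre_fps_radius[OF w]
  let ?F = "legendre_fps \<nu> c" and ?D = "fps_deriv (legendre_fps \<nu> c)"
  have rX: "ereal (norm w) < fps_conv_radius (fps_X :: complex fps)"
    and rC: "ereal (norm w) < fps_conv_radius (fps_const a :: complex fps)"
    and r1: "ereal (norm w) < fps_conv_radius (1 - fps_X :: complex fps)" for a
    by (auto intro: less_le_trans[OF _ fps_conv_radius_diff])
  have mult: "ereal (norm w) < fps_conv_radius (f * g)"
    if "ereal (norm w) < fps_conv_radius f" "ereal (norm w) < fps_conv_radius g" for f g :: "complex fps"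
    by (rule less_le_trans[OF _ fps_conv_radius_mult]) (use that in simp)
  have diff: "ereal (norm w) < fps_conv_radius (f - g)"
    if "ereal (norm w) < fps_conv_radius f" "ereal (norm w) < fps_conv_radius g" for f g :: "complex fps"
    by (rule less_le_trans[OF _ fps_conv_radius_diff]) (use that in simp)
  have "(eval_fps ?F has_field_derivative eval_fps ?D w) (at w)"
    by (rule has_field_derivative_eval_fps[OF r(1)])
  then show "(legendre_hyp \<nu> c has_field_derivative eval_fps ?D w) (at w)"
    by (simp only: eval_legendre_fps[abs_def])
  have "eval_fps (fps_X * ?D + fps_const (c - 1) * ?F) w = eval_fps (legendre_fps \<nu> (c - 1)) w"
    by (simp only: legendre_fps_lower_c)
  then show "w * eval_fps ?D w + (c - 1) * legendre_hyp \<nu> c w = legendre_hyp \<nu> (c - 1) w"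
    by (simp add: eval_fps_add eval_fps_mult mult rX rC r eval_legendre_fps del: fps_const_sub fps_const_mult)
  have "eval_fps (fps_const 2 * fps_X * (1 - fps_X) * ?D) w =
     eval_fps (fps_const (\<nu> - (c - 1)) * (?F - legendre_fps (\<nu> - 1) c) - fps_const (2 * \<nu>) * fps_X * ?F) w"
    using legendre_fps_degree_relation[of \<nu> "c - 1"] by simp
  then show "2 * w * (1 - w) * eval_fps ?D w = (\<nu> - (c - 1)) * (legendre_hyp \<nu> c w - legendre_hyp (\<nu> - 1) c w) - 2 * \<nu> * w * legendre_hyp \<nu> c w"
    using eval_legendre_fps[of "\<nu> - 1" c w]
    by (simp add: eval_fps_diff eval_fps_mult mult diff rX rC r r1 legendre_fps_radius[OF w] eval_legendre_fps[of \<nu>]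
        del: fps_const_sub fps_const_mult fps_const_mult_left fps_const_mult_right)
qed

lemma legendre_hyp_order_relation:
  assumes w: "norm w < 1"
  shows "(1 - w) * legendre_hyp \<nu> (c - 2) w - (c - 2) * (1 - 2 * w) * legendre_hyp \<nu> (c - 1) w
     + (\<nu> + c - 1) * (\<nu> - c + 2) * w * legendre_hyp \<nu> c w = 0"
proof -
  note r = legendre_fps_radius(1)[OF w]
  have rX: "ereal (norm w) < fps_conv_radius (fps_X :: complex fps)"
    and rC: "ereal (norm w) < fps_conv_radius (fps_const a :: complex fps)"
    and r1: "ereal (norm w) < fps_conv_radius (1 - fps_X :: complex fps)" for a
    by (auto intro: less_le_trans[OF _ fps_conv_radius_diff])
  have mult: "ereal (norm w) < fps_conv_radius (f * g)"
    if "ereal (norm w) < fps_conv_radius f" "ereal (norm w) < fps_conv_radius g" for f g :: "complex fps"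
    by (rule less_le_trans[OF _ fps_conv_radius_mult]) (use that in simp)
  have diff: "ereal (norm w) < fps_conv_radius (f - g)"
    if "ereal (norm w) < fps_conv_radius f" "ereal (norm w) < fps_conv_radius g" for f g :: "complex fps"
    by (rule less_le_trans[OF _ fps_conv_radius_diff]) (use that in simp)
  have r2: "ereal (norm w) < fps_conv_radius (1 - fps_const 2 * fps_X :: complex fps)"
    by (intro diff mult rC rX) simp
  have "eval_fps ((1 - fps_X) * legendre_fps \<nu> (c - 2) - fps_const (c - 2) * (1 - fps_const 2 * fps_X) * legendre_fps \<nu> (c - 1)
     + fps_const ((\<nu> + c - 1) * (\<nu> - c + 2)) * fps_X * legendre_fps \<nu> c) w = 0"
    by (simp only: legendre_fps_order_relation) (simp add: eval_fps_def)
  then show ?thesis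
    by (simp add: eval_fps_add eval_fps_diff eval_fps_mult mult diff rX rC r r1 r2 eval_legendre_fps
        del: fps_const_sub fps_const_mult fps_const_mult_left fps_const_mult_right fps_const_add)
qed

lemma norm_half_one_minus_less:
  assumes "u \<in> ball 0 1" shows "norm ((1 - u) / 2 :: complex) < 1"
proof -
  have "norm (1 - u) \<le> 1 + norm u" using norm_triangle_ineq4[of 1 u] by simp
  then show ?thesis using assms by (simp add: norm_divide)
qed

lemma Re_one_minus_pos: "u \<in> ball 0 1 \<Longrightarrow> Re (1 - u) > 0" "u \<in> ball 0 1 \<Longrightarrow> Re (1 + u) > 0"
  using complex_Re_le_cmod[of u] complex_Re_le_cmod[of "- u"] by auto

lemma one_minus_square_nonzero:
  assumes "u \<in> ball (0::complex) 1" shows "1 - u \<noteq> 0" "1 + u \<noteq> 0" "1 - u\<^sup>2 \<noteq> 0"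
proof -
  show 1: "1 - u \<noteq> 0" "1 + u \<noteq> 0"
    using Re_one_minus_pos[OF assms] by (metis less_irrefl zero_complex.sel(1))+
  have "1 - u\<^sup>2 = (1 - u) * (1 + u)" by (simp add: power2_eq_square algebra_simps)
  then show "1 - u\<^sup>2 \<noteq> 0" using 1 by simp
qed

definition ferrers_disc :: "complex \<Rightarrow> complex \<Rightarrow> complex \<Rightarrow> complex" where
  "ferrers_disc \<nu> \<mu> u = exp (\<mu> / 2 * (Ln (1 - u) - Ln (1 + u))) * legendre_hyp \<nu> (1 + \<mu>) ((1 - u) / 2)"

lemma ferrers_disc_reflect: "ferrers_disc (- \<nu> - 1) \<mu> u = ferrers_disc \<nu> \<mu> u"
  by (simp only: ferrers_disc_def legendre_hyp_reflect)

lemma ferrersP_eq_ferrers_disc: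
  assumes "-1 < x" "x < 1"
  shows "ferrersP \<nu> (- \<mu>) x = ferrers_disc \<nu> \<mu> (of_real x)"
proof -
  have "Ln (1 - of_real x) = of_real (ln (1 - x))" "Ln (1 + of_real x) = of_real (ln (1 + x))"
    using assms Ln_of_real[of "1 - x"] Ln_of_real[of "1 + x"] by simp_all
  moreover have "of_real ((1 - x) / (1 + x)) powr (\<mu> / 2) = exp (\<mu> / 2 * of_real (ln ((1 - x) / (1 + x))))"
    using assms by (subst powr_def) (simp add: Ln_of_real del: of_real_divide)
  moreover have "ln ((1 - x) / (1 + x)) = ln (1 - x) - ln (1 + x)" using assms by (simp add: ln_div)
  ultimately show ?thesis
    by (simp add: ferrersP_def ferrers_disc_def)
qed

lemma ferrers_disc_deriv:
  assumes u: "u \<in> ball 0 1"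
  shows "(ferrers_disc \<nu> \<mu> has_field_derivative
     ((\<nu> - \<mu>) * ferrers_disc (\<nu> - 1) \<mu> u - \<nu> * u * ferrers_disc \<nu> \<mu> u) / (1 - u\<^sup>2)) (at u)"
proof -
  define w where "w = (1 - u) / 2"
  define H where "H = legendre_hyp \<nu> (1 + \<mu>) w"
  define H' where "H' = legendre_hyp (\<nu> - 1) (1 + \<mu>) w"
  define E where "E = exp (\<mu> / 2 * (Ln (1 - u) - Ln (1 + u)))"
  note nz = one_minus_square_nonzero[OF u]
  have w: "norm w < 1" using norm_half_one_minus_less[OF u] by (simp add: w_def)
  obtain D where D: "(legendre_hyp \<nu> (1 + \<mu>) has_field_derivative D) (at w)"
    "2 * w * (1 - w) * D = (\<nu> - \<mu>) * (H - H') - 2 * \<nu> * w * H"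
    using legendre_hyp_deriv[OF w, of \<nu> "1 + \<mu>"] by (auto simp: H_def H'_def)
  have np: "1 - u \<notin> \<real>\<^sub>\<le>\<^sub>0" "1 + u \<notin> \<real>\<^sub>\<le>\<^sub>0"
    using Re_one_minus_pos[OF u] by (auto simp: complex_nonpos_Reals_iff)
  have dw: "((\<lambda>u. (1 - u) / 2) has_field_derivative - 1 / 2) (at u)"
    by (auto intro!: derivative_eq_intros)
  have dH: "((\<lambda>u. legendre_hyp \<nu> (1 + \<mu>) ((1 - u) / 2)) has_field_derivative D * (- 1 / 2)) (at u)"
    by (rule DERIV_chain2[OF _ dw]) (use D w_def in simp)
  have dE: "((\<lambda>u. exp (\<mu> / 2 * (Ln (1 - u) - Ln (1 + u)))) has_field_derivative E * (\<mu> / 2 * (- 1 / (1 - u) - 1 / (1 + u)))) (at u)"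
  proof -
    have "((\<lambda>u. Ln (1 - u) - Ln (1 + u)) has_field_derivative - 1 / (1 - u) - 1 / (1 + u)) (at u)"
      using np by (auto intro!: derivative_eq_intros simp: divide_inverse)
    from DERIV_chain2[OF DERIV_exp DERIV_cmult[OF this, of "\<mu> / 2"]] show ?thesis by (simp only: E_def)
  qed
  have d: "(ferrers_disc \<nu> \<mu> has_field_derivative
     (E * (\<mu> / 2 * (- 1 / (1 - u) - 1 / (1 + u)))) * H + D * (- 1 / 2) * E) (at u)"
    unfolding ferrers_disc_def[abs_def]
    using DERIV_mult[OF dE dH] by (simp add: E_def H_def w_def)
  have q: "1 - u\<^sup>2 = (1 - u) * (1 + u)" by (simp add: power2_eq_square algebra_simps)
  have D4: "(1 - u\<^sup>2) * D = 2 * ((\<nu> - \<mu>) * (H - H') - 2 * \<nu> * w * H)"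
  proof -
    have "(1 - u\<^sup>2) * D = 2 * (2 * w * (1 - w) * D)"
      by (simp add: w_def power2_eq_square field_simps)
    then show ?thesis by (simp only: D)
  qed
  have "(1 - u\<^sup>2) * ((E * (\<mu> / 2 * (- 1 / (1 - u) - 1 / (1 + u)))) * H + D * (- 1 / 2) * E)
      = - \<mu> * E * H - E / 2 * ((1 - u\<^sup>2) * D)"
  proof -
    have "(1 - u\<^sup>2) * (\<mu> / 2 * (- 1 / (1 - u) - 1 / (1 + u))) = - \<mu>"
      unfolding q using nz by (simp add: divide_simps)
    moreover have "a * ((E * m) * H + D * (- 1 / 2) * E) = (a * m) * E * H - E / 2 * (a * D)" for a m
      by (simp add: algebra_simps)
    ultimately show ?thesis by (simp only:)
  qed
  also have "\<dots> = (\<nu> - \<mu>) * (E * H') - \<nu> * u * (E * H)"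
    unfolding D4 by (simp add: w_def field_simps)
  also have "\<dots> = (\<nu> - \<mu>) * ferrers_disc (\<nu> - 1) \<mu> u - \<nu> * u * ferrers_disc \<nu> \<mu> u"
    by (simp add: ferrers_disc_def E_def H_def H'_def w_def)
  finally have "(E * (\<mu> / 2 * (- 1 / (1 - u) - 1 / (1 + u)))) * H + D * (- 1 / 2) * E
      = ((\<nu> - \<mu>) * ferrers_disc (\<nu> - 1) \<mu> u - \<nu> * u * ferrers_disc \<nu> \<mu> u) / (1 - u\<^sup>2)"
    using nz by (simp add: nonzero_eq_divide_eq mult.commute)
  then show ?thesis using d by simp
qed

lemma ferrers_disc_deriv':
  assumes u: "u \<in> ball 0 1"
  shows "(ferrers_disc (\<nu> - 1) \<mu> has_field_derivative
     (\<nu> * u * ferrers_disc (\<nu> - 1) \<mu> u - (\<nu> + \<mu>) * ferrers_disc \<nu> \<mu> u) / (1 - u\<^sup>2)) (at u)"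
proof -
  have "ferrers_disc (- \<nu>) \<mu> = ferrers_disc (\<nu> - 1) \<mu>" "ferrers_disc (- \<nu> - 1) \<mu> = ferrers_disc \<nu> \<mu>"
    using ferrers_disc_reflect[of "\<nu> - 1" \<mu>] ferrers_disc_reflect[of \<nu> \<mu>] by (auto simp: fun_eq_iff)
  then show ?thesis using ferrers_disc_deriv[OF u, of "- \<nu>" \<mu>] by (simp add: algebra_simps)
qed

lemma ferrers_disc_three_term:
  assumes u: "u \<in> ball 0 1"
  shows "(\<nu> + \<mu> + 1) * ferrers_disc (\<nu> + 1) \<mu> u - (2 * \<nu> + 1) * u * ferrers_disc \<nu> \<mu> u
      + (\<nu> - \<mu>) * ferrers_disc (\<nu> - 1) \<mu> u = 0"
proof -
  have "((\<nu> - \<mu>) * ferrers_disc (\<nu> - 1) \<mu> u - \<nu> * u * ferrers_disc \<nu> \<mu> u) / (1 - u\<^sup>2) =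
    ((\<nu> + 1) * u * ferrers_disc \<nu> \<mu> u - (\<nu> + 1 + \<mu>) * ferrers_disc (\<nu> + 1) \<mu> u) / (1 - u\<^sup>2)"
    using DERIV_unique[OF ferrers_disc_deriv[OF u] ferrers_disc_deriv'[OF u, of "\<nu> + 1" \<mu>, simplified]] by simp
  then show ?thesis using one_minus_square_nonzero[OF u] by (simp add: algebra_simps)
qed

lemma ferrers_disc_holomorphic: "ferrers_disc \<nu> \<mu> holomorphic_on ball 0 1"
  unfolding holomorphic_on_def field_differentiable_def
  using ferrers_disc_deriv has_field_derivative_at_within by blast

lemma open_cut_plane: "open cut_plane"
proof -
  have "closed (complex_of_real ` ({..-1} \<union> {1..}))"
    by (intro closed_Un closed_injective_linear_image[of _ complex_of_real])
       (auto intro!: closed_Un linearI simp: inj_def scaleR_conv_of_real)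
  then show ?thesis by (simp add: cut_plane_def open_Compl)
qed

lemma closed_segment_cut_plane:
  assumes "z \<in> cut_plane" shows "closed_segment 0 z \<subseteq> cut_plane"
proof
  fix w assume "w \<in> closed_segment 0 z"
  then obtain t where t: "0 \<le> t" "t \<le> 1" "w = of_real t * z" by (auto simp: in_segment scaleR_conv_of_real)
  show "w \<in> cut_plane"
  proof (rule ccontr)
    assume "w \<notin> cut_plane"
    then obtain y where y: "w = of_real y" "y \<le> -1 \<or> y \<ge> 1" by (auto simp: cut_plane_def)
    have t0: "t > 0" using t y by (cases "t = 0") auto
    then have "z = of_real (y / t)" using t y by (simp add: field_simps)
    moreover have "y / t \<le> -1 \<or> y / t \<ge> 1" using y t t0 by (auto simp: field_simps)
    ultimately show False using assms unfolding cut_plane_def by blast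
  qed
qed

lemma ball_subset_cut_plane: "ball 0 1 \<subseteq> cut_plane"
  by (auto simp: cut_plane_def)

lemma zero_in_cut_plane: "0 \<in> cut_plane"
  using ball_subset_cut_plane by auto

lemma one_minus_square_nonzero_cut_plane: "z \<in> cut_plane \<Longrightarrow> 1 - z\<^sup>2 \<noteq> 0"
proof
  assume "z \<in> cut_plane" "1 - z\<^sup>2 = 0"
  then have "z = 1 \<or> z = -1" by (simp add: power2_eq_1_iff)
  then obtain x :: real where "x \<in> {..-1} \<union> {1..}" "z = of_real x"
    by (metis UnCI atLeast_iff atMost_iff of_real_1 of_real_minus order_refl)
  then show False using \<open>z \<in> cut_plane\<close> unfolding cut_plane_def by blast
qed

lemma ferrersP_continuation_exists:
  "\<exists>f. f holomorphic_on cut_plane \<and> (\<forall>x\<in>{-1<..<1}. f (complex_of_real x) = ferrersP \<nu> (- \<mu>) x)"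
proof -
  define A :: "bool \<Rightarrow> bool \<Rightarrow> complex \<Rightarrow> complex" where
    "A i j z = (if i then (if j then - \<nu> * z else \<nu> - \<mu>) else (if j then - (\<nu> + \<mu>) else \<nu> * z)) / (1 - z\<^sup>2)" for i j z
  define p where "p i = (if i then ferrers_disc \<nu> \<mu> else ferrers_disc (\<nu> - 1) \<mu>)" for i
  have A: "A i j holomorphic_on cut_plane" for i j
    unfolding A_def using one_minus_square_nonzero_cut_plane by (cases i; cases j) (auto intro!: holomorphic_intros)
  obtain h where h0: "\<And>i. h i 0 = p i 0"
    and h: "\<And>i w. w \<in> cut_plane \<Longrightarrow> (h i has_field_derivative (\<Sum>j\<in>UNIV. A i j w * h j w)) (at w)"
  proof -
    have "\<exists>h. (\<forall>i. h i 0 = p i 0) \<and>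
        (\<forall>i. \<forall>w\<in>cut_plane. (h i has_field_derivative (\<Sum>j\<in>UNIV. A i j w * h j w)) (at w))"
      by (rule linear_system_solution_exists[OF A closed_segment_cut_plane open_cut_plane zero_in_cut_plane])
    then show ?thesis using that by blast
  qed
  have p: "(p i has_field_derivative (\<Sum>j\<in>UNIV. A i j w * p j w)) (at w)" if w: "w \<in> ball 0 1" for i w
    using ferrers_disc_deriv[OF w, of \<nu> \<mu>] ferrers_disc_deriv'[OF w, of \<nu> \<mu>]
    by (cases i) (simp_all add: p_def A_def UNIV_bool add_divide_distrib[symmetric] diff_divide_distrib[symmetric] algebra_simps)
  have eq: "h i w - p i w = 0" if w: "w \<in> ball 0 1" for i w
  proof (rule linear_system_unique[where h = "\<lambda>i w. h i w - p i w" and S = "ball 0 1" and A = A])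
    show "continuous_on (ball 0 1) (A i j)" for i j
      by (rule holomorphic_on_imp_continuous_on[OF holomorphic_on_subset[OF A ball_subset_cut_plane]])
    show "((\<lambda>w. h i w - p i w) has_field_derivative (\<Sum>j\<in>UNIV. A i j v * (h j v - p j v))) (at v)" if "v \<in> ball 0 1" for i v
      using DERIV_diff[OF h p, of v i] that ball_subset_cut_plane
      by (auto simp: sum_subtractf right_diff_distrib)
    show "closed_segment 0 z \<subseteq> ball 0 1" if "z \<in> ball 0 1" for z :: complex
      using that by (intro closed_segment_subset) auto
  qed (use h0 w in auto)
  have "h True holomorphic_on cut_plane"
    unfolding holomorphic_on_def field_differentiable_def
    using h has_field_derivative_at_within by blast
  moreover have "h True (of_real x) = ferrersP \<nu> (- \<mu>) x" if "x \<in> {-1<..<1}" for x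
    using eq[of "of_real x" True] that ferrersP_eq_ferrers_disc[of x \<nu> \<mu>] by (simp add: p_def abs_less_iff)
  ultimately show ?thesis by blast
qed

lemma ferrersP_hat_eq_ferrers_disc:
  assumes u: "u \<in> ball 0 1"
  shows "ferrersP_hat \<nu> (- \<mu>) u = ferrers_disc \<nu> \<mu> u"
proof -
  define f where "f = ferrersP_hat \<nu> (- \<mu>)"
  have f: "f holomorphic_on cut_plane" "\<And>x. x \<in> {-1<..<1} \<Longrightarrow> f (complex_of_real x) = ferrersP \<nu> (- \<mu>) x"
    using someI_ex[OF ferrersP_continuation_exists[of \<nu> \<mu>]] unfolding f_def ferrersP_hat_def by blast+
  have "f u - ferrers_disc \<nu> \<mu> u = 0"
  proof (rule analytic_continuation[where f = "\<lambda>u. f u - ferrers_disc \<nu> \<mu> u" and S = "ball 0 1" and U = "complex_of_real ` {-1<..<1}" and \<xi> = 0])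
    show "(\<lambda>u. f u - ferrers_disc \<nu> \<mu> u) holomorphic_on ball 0 1"
      by (intro holomorphic_intros ferrers_disc_holomorphic holomorphic_on_subset[OF f(1) ball_subset_cut_plane])
    show "0 islimpt complex_of_real ` {-1<..<1}"
      unfolding islimpt_approachable
    proof (intro allI impI)
      fix e :: real assume "e > 0"
      then have "complex_of_real (min e 1 / 2) \<in> complex_of_real ` {-1<..<1}" by (intro imageI) auto
      moreover have "complex_of_real (min e 1 / 2) \<noteq> 0" "dist (complex_of_real (min e 1 / 2)) 0 < e"
        using \<open>e > 0\<close> by (auto simp: dist_norm norm_divide)
      ultimately show "\<exists>x'\<in>complex_of_real ` {-1<..<1}. x' \<noteq> 0 \<and> dist x' 0 < e" by blast
    qed
    show "f z - ferrers_disc \<nu> \<mu> z = 0" if "z \<in> complex_of_real ` {-1<..<1}" for z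
      using that f(2) ferrersP_eq_ferrers_disc[of _ \<nu> \<mu>] by auto
  qed (use u in auto)
  then show ?thesis by (simp add: f_def)
qed

lemma degree_generating_function_deriv:
  fixes x :: complex
  defines "L \<equiv> \<lambda>s. Ln (1 - 2 * s * x + s\<^sup>2)"
  defines "u \<equiv> \<lambda>s. (x - s) * exp (- (L s / 2))"
  assumes np: "1 - 2 * s * x + s\<^sup>2 \<notin> \<real>\<^sub>\<le>\<^sub>0" and u: "u s \<in> ball 0 1"
  shows "((\<lambda>s. exp (\<nu> / 2 * L s) * ferrers_disc \<nu> \<mu> (u s)) has_field_derivative
     (\<mu> - \<nu>) * (exp ((\<nu> - 1) / 2 * L s) * ferrers_disc (\<nu> - 1) \<mu> (u s))) (at s)"
proof -
  define R where "R = 1 - 2 * s * x + s\<^sup>2"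
  define e where "e = exp (- (L s / 2))"
  have R0: "R \<noteq> 0" using np by (auto simp: R_def)
  have e2: "e * e * R = 1"
  proof -
    have "e * e = exp (- L s)" by (simp add: e_def flip: exp_add)
    then show ?thesis using R0 by (simp add: L_def R_def exp_minus)
  qed
  have e2': "1 / R = e * e" using e2 R0 by (simp add: field_simps)
  have us: "u s = (x - s) * e" by (simp add: u_def e_def)
  have dL: "(L has_field_derivative - 2 * u s * e) (at s)"
  proof -
    have "(L has_field_derivative (2 * s - 2 * x) * (1 / R)) (at s)"
      unfolding L_def R_def using np by (auto intro!: derivative_eq_intros simp: field_simps)
    then show ?thesis unfolding e2' us by (simp add: algebra_simps)
  qed
  have du: "(u has_field_derivative - e * (1 - (u s)\<^sup>2)) (at s)"
  proof -
    have "((\<lambda>s. exp (- (L s / 2))) has_field_derivative e * (u s * e)) (at s)"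
    proof -
      have "((\<lambda>s. - (L s / 2)) has_field_derivative u s * e) (at s)"
        using DERIV_cmult[OF dL, of "- (1 / 2)"] by simp
      from DERIV_chain2[OF DERIV_exp this] show ?thesis by (simp only: e_def)
    qed
    moreover have "((\<lambda>s. x - s) has_field_derivative - 1) (at s)" by (auto intro!: derivative_eq_intros)
    ultimately have "(u has_field_derivative - 1 * e + (e * (u s * e)) * (x - s)) (at s)"
      unfolding u_def e_def using DERIV_mult by blast
    then show ?thesis by (simp add: us power2_eq_square algebra_simps)
  qed
  define E where "E = exp (\<nu> / 2 * L s)"
  define P where "P = ferrers_disc \<nu> \<mu> (u s)"
  define Q where "Q = ferrers_disc (\<nu> - 1) \<mu> (u s)"
  have dE: "((\<lambda>s. exp (\<nu> / 2 * L s)) has_field_derivative E * (\<nu> / 2 * (- 2 * u s * e))) (at s)"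
    using DERIV_chain2[OF DERIV_exp DERIV_cmult[OF dL, of "\<nu> / 2"]] by (simp only: E_def)
  have dP: "((\<lambda>s. ferrers_disc \<nu> \<mu> (u s)) has_field_derivative
     ((\<nu> - \<mu>) * Q - \<nu> * u s * P) / (1 - (u s)\<^sup>2) * (- e * (1 - (u s)\<^sup>2))) (at s)"
    using DERIV_chain2[OF ferrers_disc_deriv[OF u, of \<nu> \<mu>] du] by (simp only: P_def Q_def)
  have cancel: "((\<nu> - \<mu>) * Q - \<nu> * u s * P) / (1 - (u s)\<^sup>2) * (- e * (1 - (u s)\<^sup>2)) = - e * ((\<nu> - \<mu>) * Q - \<nu> * u s * P)"
    using one_minus_square_nonzero(3)[OF u] by simp
  have Ee: "exp ((\<nu> - 1) / 2 * L s) = E * e"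
    by (simp add: E_def e_def algebra_simps diff_divide_distrib flip: exp_add)
  show ?thesis
    using DERIV_mult[OF dE dP] unfolding cancel Ee E_def[symmetric] P_def[symmetric] Q_def[symmetric]
    by (simp add: algebra_simps)
qed

context
  fixes \<mu> \<nu> :: complex and x :: real
  assumes x: "-1 < x" "x < 1"
begin

definition degree_coeff :: "nat \<Rightarrow> complex" where
  "degree_coeff n = pochhammer (\<mu> - \<nu>) n * ferrersP (of_nat n - \<nu> - 1) (- \<mu>) x"

lemma of_real_in_unit_ball: "complex_of_real x \<in> ball 0 1"
  using x by (simp add: abs_less_iff)

lemma degree_coeff_eq: "degree_coeff n = pochhammer (\<mu> - \<nu>) n * ferrers_disc (of_nat n - \<nu> - 1) \<mu> (of_real x)"
  by (simp add: degree_coeff_def ferrersP_eq_ferrers_disc[OF x])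

lemma degree_generating_function_germ:
  "\<forall>\<^sub>F s in nhds 0. (\<lambda>n. degree_coeff n * (s ^ n / fact n)) sums
     ((1 - 2 * s * of_real x + s\<^sup>2) powr (\<nu> / 2) *
       ferrersP_hat \<nu> (- \<mu>) ((of_real x - s) / csqrt (1 - 2 * s * of_real x + s\<^sup>2)))"
proof -
  define L where "L s = Ln (1 - 2 * s * complex_of_real x + s\<^sup>2)" for s
  define u where "u s = (complex_of_real x - s) * exp (- (L s / 2))" for s
  define F where "F n s = pochhammer (\<mu> - \<nu>) n * (exp ((\<nu> - of_nat n) / 2 * L s) * ferrers_disc (\<nu> - of_nat n) \<mu> (u s))" for n s
  define R where "R s = 1 - 2 * s * complex_of_real x + s\<^sup>2" for s
  have R: "isCont R 0" unfolding R_def by (intro continuous_intros)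
  have u: "isCont u 0"
    unfolding u_def L_def by (intro continuous_intros) auto
  have "R 0 = 1" "u 0 = of_real x" by (simp_all add: R_def u_def L_def)
  then have lim: "(R \<longlongrightarrow> 1) (nhds 0)" "(u \<longlongrightarrow> of_real x) (nhds 0)"
    using R u unfolding isCont_def tendsto_at_iff_tendsto_nhds by auto
  have "\<forall>\<^sub>F s in nhds 0. R s \<in> - \<real>\<^sub>\<le>\<^sub>0"
    by (rule topological_tendstoD[OF lim(1)]) (simp_all add: open_Compl)
  moreover have "\<forall>\<^sub>F s in nhds 0. u s \<in> ball 0 1"
    by (rule topological_tendstoD[OF lim(2) open_ball of_real_in_unit_ball])
  ultimately have "\<forall>\<^sub>F s in nhds 0. R s \<notin> \<real>\<^sub>\<le>\<^sub>0 \<and> u s \<in> ball 0 1"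
    by eventually_elim simp
  then obtain e where e: "e > 0" "\<And>s. s \<in> ball 0 e \<Longrightarrow> 1 - 2 * s * complex_of_real x + s\<^sup>2 \<notin> \<real>\<^sub>\<le>\<^sub>0 \<and> u s \<in> ball 0 1"
    unfolding eventually_nhds_metric R_def by (auto simp: dist_commute)
  have dF: "(F n has_field_derivative F (Suc n) s) (at s)" if "s \<in> ball 0 e" for n s
  proof -
    have "((\<lambda>s. exp ((\<nu> - of_nat n) / 2 * L s) * ferrers_disc (\<nu> - of_nat n) \<mu> (u s)) has_field_derivative
     (\<mu> - (\<nu> - of_nat n)) * (exp ((\<nu> - of_nat n - 1) / 2 * L s) * ferrers_disc (\<nu> - of_nat n - 1) \<mu> (u s))) (at s)"
      unfolding L_def u_def
      by (rule degree_generating_function_deriv) (use e(2)[OF that] in \<open>auto simp: u_def L_def\<close>)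
    from DERIV_cmult[OF this, of "pochhammer (\<mu> - \<nu>) n"] show ?thesis
      unfolding F_def by (simp add: pochhammer_Suc algebra_simps)
  qed
  have F0: "F n 0 = degree_coeff n" for n
  proof -
    have "of_nat n - \<nu> - 1 = - (\<nu> - of_nat n) - 1" by simp
    then have "ferrers_disc (of_nat n - \<nu> - 1) \<mu> (of_real x) = ferrers_disc (\<nu> - of_nat n) \<mu> (of_real x)"
      by (simp only: ferrers_disc_reflect)
    then show ?thesis by (simp add: F_def degree_coeff_eq u_def L_def)
  qed
  have "\<forall>\<^sub>F s in nhds 0. s \<in> ball 0 e" using e(1) by (intro eventually_nhds_in_open) auto
  then show ?thesis
  proof eventually_elim
    case (elim s)
    define R where "R = 1 - 2 * s * complex_of_real x + s\<^sup>2"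
    have R: "R \<noteq> 0" and us: "u s \<in> ball 0 1" using e(2)[OF elim] by (auto simp: R_def)
    have "csqrt R = exp (L s / 2)" using R by (simp add: csqrt_exp_Ln L_def R_def)
    then have "(of_real x - s) / csqrt R = u s" by (simp add: u_def exp_minus field_simps)
    moreover have "R powr (\<nu> / 2) = exp (\<nu> / 2 * L s)" using R by (simp add: powr_def L_def R_def)
    ultimately have "R powr (\<nu> / 2) * ferrersP_hat \<nu> (- \<mu>) ((of_real x - s) / csqrt R) = F 0 s"
      by (simp add: F_def ferrersP_hat_eq_ferrers_disc[OF us])
    then show ?case using taylor_family[where F = F and e = e, OF dF elim] by (simp add: F0 R_def)
  qed
qed

lemma degree_coeff_recurrence:
  fixes l1 l2 :: complex
  assumes l: "l1 + l2 = 2 * of_real x" "l1 * l2 = 1"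
  shows "of_nat (n+1) * of_nat (n+2) * (degree_coeff (n+2) / fact (n+2)) =
      (l1 + l2) * of_nat (n+1) * (of_nat (n+2) - (\<nu> + 3/2)) * (degree_coeff (n+1) / fact (n+1))
      - l1 * l2 * ((of_nat n)\<^sup>2 + (3 - 2*(\<nu> + 3/2)) * of_nat n + (\<nu>\<^sup>2 - \<mu>\<^sup>2)) * (degree_coeff n / fact n)"
proof -
  define t where "t = (of_nat n :: complex)"
  define p where "p m = ferrers_disc (of_nat m - \<nu> - 1) \<mu> (of_real x)" for m
  define X where "X = pochhammer (\<mu> - \<nu>) n / fact n"
  define cc where "cc = degree_coeff (n+1) / fact (n+1)"
  have nz: "t + 1 \<noteq> 0" "t + 2 \<noteq> 0"
    using of_nat_neq_0[of n, where 'a=complex] of_nat_neq_0[of "Suc n", where 'a=complex]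
    by (auto simp: t_def add_ac)
  have tt: "(t - \<nu> + \<mu> + 1) * p (n+2) - (2 * (t - \<nu>) + 1) * of_real x * p (n+1) + (t - \<nu> - \<mu>) * p n = 0"
    using ferrers_disc_three_term[OF of_real_in_unit_ball, of "t - \<nu>" \<mu>]
    by (simp add: p_def t_def algebra_simps)
  have c: "degree_coeff n / fact n = X * p n"
    "of_nat (n+1) * (degree_coeff (n+1) / fact (n+1)) = X * (\<mu> - \<nu> + t) * p (n+1)"
    "of_nat (n+1) * of_nat (n+2) * (degree_coeff (n+2) / fact (n+2)) = X * (\<mu> - \<nu> + t) * (\<mu> - \<nu> + t + 1) * p (n+2)"
    using nz unfolding degree_coeff_eq p_def X_def
    by (simp_all add: pochhammer_Suc t_def[symmetric] fact_Suc divide_simps) (simp_all add: algebra_simps)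
  have "X * (\<mu> - \<nu> + t) * (\<mu> - \<nu> + t + 1) * p (n+2) = X * (\<mu> - \<nu> + t) * ((t - \<nu> + \<mu> + 1) * p (n+2))"
    by (simp add: algebra_simps)
  also have "(t - \<nu> + \<mu> + 1) * p (n+2) = (2 * (t - \<nu>) + 1) * of_real x * p (n+1) - (t - \<nu> - \<mu>) * p n"
    using tt by (simp add: algebra_simps)
  also have "X * (\<mu> - \<nu> + t) * \<dots> = 2 * of_real x * (of_nat (n+2) - (\<nu> + 3/2)) * (X * (\<mu> - \<nu> + t) * p (n+1))
      - (t\<^sup>2 + (3 - 2*(\<nu> + 3/2)) * t + (\<nu>\<^sup>2 - \<mu>\<^sup>2)) * (X * p n)"
    by (simp add: t_def[symmetric] power2_eq_square algebra_simps)
  finally show ?thesis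
    unfolding c(3) l c(1) t_def[symmetric] c(2)[symmetric] cc_def[symmetric] by (simp only: mult_ac mult_1_left)
qed

lemma conjugate_roots:
  obtains l1 l2 :: complex where "l1 + l2 = 2 * of_real x" "l1 * l2 = 1" "l1 \<noteq> l2" "norm l1 = 1" "norm l2 = 1"
proof -
  define y where "y = sqrt (1 - x\<^sup>2)"
  have "x\<^sup>2 < 1" using x by (simp add: abs_square_less_1)
  then have y: "y > 0" "y\<^sup>2 = 1 - x\<^sup>2" by (simp_all add: y_def)
  show ?thesis
  proof (rule that[of "Complex x y" "Complex x (- y)"])
    show "Complex x y * Complex x (- y) = 1" using y by (simp add: complex_eq_iff power2_eq_square)
    show "norm (Complex x y) = 1" "norm (Complex x (- y)) = 1" using y by (simp_all add: cmod_def)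
  qed (use y in \<open>simp_all add: complex_eq_iff\<close>)
qed

lemma exp_generating_on_degree:
  defines "f1 \<equiv> \<lambda>s. (1 - 2 * s * of_real x + s\<^sup>2) powr (\<nu> / 2) *
           ferrersP_hat \<nu> (- \<mu>) ((of_real x - s) / csqrt (1 - 2 * s * of_real x + s\<^sup>2))"
  shows "\<nu> - \<mu> \<in> \<nat> \<Longrightarrow> exp_generating_on UNIV degree_coeff f1"
    and "exp_generating_on (ball 0 1) degree_coeff f1"
    and "Re \<nu> > -1/2 \<Longrightarrow> exp_generating_on (cball 0 1) degree_coeff f1"
proof -
  obtain l1 l2 :: complex where l: "l1 + l2 = 2 * of_real x" "l1 * l2 = 1" and ne: "l1 \<noteq> l2" "norm l1 = 1" "norm l2 = 1"
    by (rule conjugate_roots)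
  note rec = degree_coeff_recurrence[OF l]
  have n: "norm l1 \<le> 1" "norm l2 \<le> 1" using ne by auto
  have germ: "\<forall>\<^sub>F s in nhds 0. (\<lambda>n. degree_coeff n * (s ^ n / fact n)) sums f1 s"
    unfolding f1_def by (rule degree_generating_function_germ)
  show "exp_generating_on (ball 0 1) degree_coeff f1"
    by (rule exp_generating_on_ball[OF second_order_recurrence_summable_powser[OF rec ne(1) n] germ])
  show "exp_generating_on (cball 0 1) degree_coeff f1" if "Re \<nu> > -1/2"
    using second_order_recurrence_summable[OF rec ne(1) n] that
    by (intro exp_generating_on_cball germ) simp_all
  show "exp_generating_on UNIV degree_coeff f1" if nm: "\<nu> - \<mu> \<in> \<nat>"
  proof (rule exp_generating_on_open[OF open_UNIV _ germ])
    obtain m where m: "\<nu> - \<mu> = of_nat m" using nm unfolding Nats_def by auto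
    have "\<mu> - \<nu> = - of_nat m" using m by (simp add: algebra_simps)
    then have "degree_coeff k = 0" if "k \<notin> {..m}" for k
      using that by (simp add: degree_coeff_def pochhammer_of_nat_eq_0_iff)
    then show "\<exists>r>norm s. summable (\<lambda>k. norm (degree_coeff k / fact k) * r ^ k)" for s :: complex
      by (intro exI[of _ "norm s + 1"] conjI summable_finite[of "{..m}"]) auto
  qed
qed

end

definition order_fun :: "complex \<Rightarrow> complex \<Rightarrow> complex \<Rightarrow> complex" where
  "order_fun \<nu> \<mu> u = exp (\<mu> * Ln (1 - u)) * legendre_hyp \<nu> (1 + \<mu>) ((1 - u) / 2)"

lemma exp_times_Ln_minus_1:
  assumes "z \<noteq> 0" shows "exp ((\<mu> - 1) * Ln z) = exp (\<mu> * Ln z) / z"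
  using assms by (simp add: left_diff_distrib exp_diff)

lemma order_fun_deriv:
  assumes u: "u \<in> ball 0 1"
  shows "(order_fun \<nu> \<mu> has_field_derivative - order_fun \<nu> (\<mu> - 1) u) (at u)"
proof -
  define w where "w = (1 - u) / 2"
  define H where "H = legendre_hyp \<nu> (1 + \<mu>) w"
  define E where "E = exp (\<mu> * Ln (1 - u))"
  note nz = one_minus_square_nonzero[OF u]
  have w: "norm w < 1" using norm_half_one_minus_less[OF u] by (simp add: w_def)
  obtain D where D: "(legendre_hyp \<nu> (1 + \<mu>) has_field_derivative D) (at w)"
    "w * D + \<mu> * H = legendre_hyp \<nu> \<mu> w"
    using legendre_hyp_deriv[OF w, of \<nu> "1 + \<mu>"] by (auto simp: H_def)
  have np: "1 - u \<notin> \<real>\<^sub>\<le>\<^sub>0"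
    using Re_one_minus_pos[OF u] by (auto simp: complex_nonpos_Reals_iff)
  have dw: "((\<lambda>u. (1 - u) / 2) has_field_derivative - 1 / 2) (at u)"
    by (auto intro!: derivative_eq_intros)
  have dH: "((\<lambda>u. legendre_hyp \<nu> (1 + \<mu>) ((1 - u) / 2)) has_field_derivative D * (- 1 / 2)) (at u)"
    by (rule DERIV_chain2[OF _ dw]) (use D w_def in simp)
  have dE: "((\<lambda>u. exp (\<mu> * Ln (1 - u))) has_field_derivative E * (\<mu> * (- 1 / (1 - u)))) (at u)"
  proof -
    have "((\<lambda>u. Ln (1 - u)) has_field_derivative - 1 / (1 - u)) (at u)"
      using np by (auto intro!: derivative_eq_intros simp: divide_inverse)
    from DERIV_chain2[OF DERIV_exp DERIV_cmult[OF this, of \<mu>]] show ?thesis by (simp only: E_def)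
  qed
  have d: "(order_fun \<nu> \<mu> has_field_derivative (E * (\<mu> * (- 1 / (1 - u)))) * H + D * (- 1 / 2) * E) (at u)"
    unfolding order_fun_def[abs_def]
    using DERIV_mult[OF dE dH] by (simp add: E_def H_def w_def)
  have "order_fun \<nu> (\<mu> - 1) u = E / (1 - u) * (w * D + \<mu> * H)"
    unfolding order_fun_def D(2) using exp_times_Ln_minus_1[OF nz(1), of \<mu>] by (simp add: E_def w_def)
  also have "\<dots> = - ((E * (\<mu> * (- 1 / (1 - u)))) * H + D * (- 1 / 2) * E)"
    using nz by (simp add: w_def divide_simps) (simp add: algebra_simps)
  finally have e: "order_fun \<nu> (\<mu> - 1) u = - ((E * (\<mu> * (- 1 / (1 - u)))) * H + D * (- 1 / 2) * E)" .
  show ?thesis unfolding e minus_minus by (rule d)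
qed

lemma order_fun_three_term:
  assumes u: "u \<in> ball 0 1"
  shows "(1 - u\<^sup>2) * order_fun \<nu> (m - 2) u - 2 * (m - 1) * u * order_fun \<nu> (m - 1) u
      + (\<nu> + m) * (\<nu> - m + 1) * order_fun \<nu> m u = 0"
proof -
  define w where "w = (1 - u) / 2"
  have w: "norm w < 1" using norm_half_one_minus_less[OF u] by (simp add: w_def)
  define E where "E = exp (m * Ln (1 - u)) / (1 - u)"
  note nz = one_minus_square_nonzero[OF u]
  define H0 H1 H2 where "H0 = legendre_hyp \<nu> (1 + m) w" and "H1 = legendre_hyp \<nu> m w" and "H2 = legendre_hyp \<nu> (m - 1) w"
  have J: "order_fun \<nu> m u = E * (1 - u) * H0" "order_fun \<nu> (m - 1) u = E * H1" "order_fun \<nu> (m - 2) u = E / (1 - u) * H2"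
    using nz exp_times_Ln_minus_1[OF nz(1), of m] exp_times_Ln_minus_1[OF nz(1), of "m - 1"]
    by (simp_all add: order_fun_def E_def H0_def H1_def H2_def w_def diff_diff_eq)
  have rel: "(1 - w) * H2 - (m - 1) * (1 - 2 * w) * H1 + (\<nu> + m) * (\<nu> - m + 1) * w * H0 = 0"
    using legendre_hyp_order_relation[OF w, of \<nu> "1 + m"]
    by (simp add: H0_def H1_def H2_def diff_diff_eq) (simp add: algebra_simps)
  have "(1 - u\<^sup>2) * (E / (1 - u) * H2) = E * (1 + u) * H2"
  proof -
    have "1 - u\<^sup>2 = (1 - u) * (1 + u)" by (simp add: power2_eq_square algebra_simps)
    then show ?thesis using nz by simp
  qed
  then have "(1 - u\<^sup>2) * order_fun \<nu> (m - 2) u - 2 * (m - 1) * u * order_fun \<nu> (m - 1) u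
      + (\<nu> + m) * (\<nu> - m + 1) * order_fun \<nu> m u =
      E * 2 * ((1 - w) * H2 - (m - 1) * (1 - 2 * w) * H1 + (\<nu> + m) * (\<nu> - m + 1) * w * H0)"
    unfolding J by (simp add: w_def field_simps)
  then show ?thesis by (simp add: rel)
qed

lemma ferrers_disc_eq_order_fun:
  assumes u: "u \<in> ball 0 1"
  shows "(1 - u\<^sup>2) powr (\<mu> / 2) * ferrers_disc \<nu> \<mu> u = order_fun \<nu> \<mu> u"
proof -
  note nz = one_minus_square_nonzero[OF u]
  have "\<bar>Im (Ln (1 - u))\<bar> < pi / 2" "\<bar>Im (Ln (1 + u))\<bar> < pi / 2"
    using Re_Ln_pos_lt[of "1 - u"] Re_Ln_pos_lt[of "1 + u"] Re_one_minus_pos[OF u] nz by blast+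
  then have "Ln ((1 - u) * (1 + u)) = Ln (1 - u) + Ln (1 + u)"
    using nz by (intro Ln_times_simple) auto
  moreover have "(1 - u) * (1 + u) = 1 - u\<^sup>2" by (simp add: power2_eq_square algebra_simps)
  ultimately have L: "Ln (1 - u\<^sup>2) = Ln (1 - u) + Ln (1 + u)" by simp
  have "(1 - u\<^sup>2) powr (\<mu> / 2) * exp (\<mu> / 2 * (Ln (1 - u) - Ln (1 + u))) = exp (\<mu> * Ln (1 - u))"
    using nz by (simp add: powr_def L field_simps flip: exp_add)
  then show ?thesis by (simp add: ferrers_disc_def order_fun_def flip: mult.assoc)
qed

context
  fixes \<mu> \<nu> :: complex and x :: real
  assumes x: "-1 < x" "x < 1"
begin

definition order_coeff :: "nat \<Rightarrow> complex" where
  "order_coeff n = ferrersP \<nu> (of_nat n - \<mu>) x / complex_of_real (1 - x\<^sup>2) powr ((of_nat n - \<mu>) / 2)"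

definition order_generating_fun :: "complex \<Rightarrow> complex" where
  "order_generating_fun s = (1 - (of_real x - s)\<^sup>2) powr (\<mu> / 2) * ferrersP_hat \<nu> (- \<mu>) (of_real x - s)"

lemma order_coeff_eq: "order_coeff n = order_fun \<nu> (\<mu> - of_nat n) (of_real x)"
proof -
  have u: "complex_of_real x \<in> ball 0 1" by (rule of_real_in_unit_ball[OF x])
  have "order_coeff n = ferrers_disc \<nu> (\<mu> - of_nat n) (of_real x) * (1 - (complex_of_real x)\<^sup>2) powr (- ((of_nat n - \<mu>) / 2))"
    using ferrersP_eq_ferrers_disc[OF x, of \<nu> "\<mu> - of_nat n"]
    by (simp add: order_coeff_def powr_minus field_simps)
  also have "- ((of_nat n - \<mu>) / 2) = (\<mu> - of_nat n) / 2" by (simp add: field_simps)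
  finally show ?thesis by (simp only: ferrers_disc_eq_order_fun[OF u, symmetric] mult.commute)
qed

lemma of_real_minus_in_unit_ball:
  assumes "s \<in> ball 0 (1 - \<bar>x\<bar>)" shows "complex_of_real x - s \<in> ball 0 1"
  using assms norm_triangle_ineq4[of "complex_of_real x" s] by simp

lemma order_generating_fun_eq:
  assumes "s \<in> ball 0 (1 - \<bar>x\<bar>)"
  shows "order_generating_fun s = order_fun \<nu> \<mu> (of_real x - s)"
  using of_real_minus_in_unit_ball[OF assms]
  by (simp only: order_generating_fun_def ferrersP_hat_eq_ferrers_disc ferrers_disc_eq_order_fun)

lemma order_family_deriv:
  assumes s: "s \<in> ball 0 (1 - \<bar>x\<bar>)"
  shows "((\<lambda>s. order_fun \<nu> (\<mu> - of_nat n) (of_real x - s)) has_field_derivative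
           order_fun \<nu> (\<mu> - of_nat (Suc n)) (of_real x - s)) (at s)"
proof -
  have "((\<lambda>s. complex_of_real x - s) has_field_derivative - 1) (at s)" by (auto intro!: derivative_eq_intros)
  from DERIV_chain2[OF order_fun_deriv[OF of_real_minus_in_unit_ball[OF s], of \<nu> "\<mu> - of_nat n"] this]
  show ?thesis by (simp add: diff_diff_eq add.commute)
qed

lemma eventually_ball_x: "\<forall>\<^sub>F s in nhds 0. s \<in> ball (0::complex) (1 - \<bar>x\<bar>)"
  using x by (intro eventually_nhds_in_open) auto

lemma order_germ: "\<forall>\<^sub>F s in nhds 0. (\<lambda>n. order_coeff n * (s ^ n / fact n)) sums order_generating_fun s"
  using eventually_ball_x
proof eventually_elim
  case (elim s)
  show ?case
    using taylor_family[where F = "\<lambda>n s. order_fun \<nu> (\<mu> - of_nat n) (of_real x - s)", OF order_family_deriv elim]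
    by (simp add: order_generating_fun_eq[OF elim] order_coeff_eq)
qed

lemma exp_generating_on_order_holomorphic:
  assumes G: "G holomorphic_on D" and D: "open D" "\<And>s. s \<in> D \<Longrightarrow> \<exists>r>norm s. ball 0 r \<subseteq> D"
    and eq: "\<And>s. s \<in> ball 0 (1 - \<bar>x\<bar>) \<Longrightarrow> G s = order_fun \<nu> \<mu> (of_real x - s)"
  shows "exp_generating_on D order_coeff order_generating_fun"
proof (rule exp_generating_on_holomorphic[OF G D])
  show "\<forall>\<^sub>F s in nhds 0. order_generating_fun s = G s"
    using eventually_ball_x by eventually_elim (simp add: order_generating_fun_eq eq)
  fix n
  have "\<forall>\<^sub>F s in nhds 0. G s = order_fun \<nu> (\<mu> - of_nat 0) (of_real x - s)"
    using eventually_ball_x by eventually_elim (simp add: eq)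
  then have "(deriv ^^ n) G 0 = (deriv ^^ n) (\<lambda>s. order_fun \<nu> (\<mu> - of_nat 0) (of_real x - s)) 0"
    by (rule higher_deriv_cong_ev) simp
  also have "\<dots> = order_fun \<nu> (\<mu> - of_nat n) (of_real x - 0)"
    by (rule higher_deriv_family[where F = "\<lambda>n s. order_fun \<nu> (\<mu> - of_nat n) (of_real x - s)", OF order_family_deriv])
       (use x in auto)
  finally show "(deriv ^^ n) G 0 = order_coeff n" by (simp add: order_coeff_eq)
qed

lemma exp_generating_on_order_ball: "exp_generating_on (ball 0 (1 - \<bar>x\<bar>)) order_coeff order_generating_fun"
proof (rule exp_generating_on_order_holomorphic)
  show "(\<lambda>s. order_fun \<nu> \<mu> (of_real x - s)) holomorphic_on ball 0 (1 - \<bar>x\<bar>)"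
  proof -
    have "((\<lambda>s. order_fun \<nu> \<mu> (of_real x - s)) has_field_derivative order_fun \<nu> (\<mu> - 1) (of_real x - s)) (at s)"
      if "s \<in> ball 0 (1 - \<bar>x\<bar>)" for s using order_family_deriv[OF that, of 0] by simp
    then show ?thesis
      unfolding holomorphic_on_def field_differentiable_def using has_field_derivative_at_within by blast
  qed
qed auto

lemma order_coeff_recurrence:
  "(1 - (of_real x)\<^sup>2) * order_coeff (n + 2) - 2 * (\<mu> - of_nat n - 1) * of_real x * order_coeff (n + 1)
     + (\<nu> + \<mu> - of_nat n) * (\<nu> - \<mu> + of_nat n + 1) * order_coeff n = 0"
  using order_fun_three_term[OF of_real_in_unit_ball[OF x], of \<nu> "\<mu> - of_nat n"]
  by (simp add: order_coeff_eq algebra_simps)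

lemma exp_generating_on_order_cball:
  assumes \<mu>: "Re \<mu> > 0"
  shows "exp_generating_on (cball 0 (1 - \<bar>x\<bar>)) order_coeff order_generating_fun"
proof -
  define r where "r = 1 - \<bar>x\<bar>"
  have r: "r > 0" using x by (simp add: r_def)
  define l1 l2 where "l1 = complex_of_real (- r / (1 - x))" and "l2 = complex_of_real (r / (1 + x))"
  define c where "c n = order_coeff n / fact n * of_real r ^ n" for n
  have "(of_nat (n+1) * of_nat (n+2)) * c (n+2) =
      (l1 + l2) * of_nat (n+1) * (of_nat (n+2) - (1 + \<mu>)) * c (n+1)
      - l1 * l2 * ((of_nat n)\<^sup>2 + (3 - 2*(1 + \<mu>)) * of_nat n - (\<nu> + \<mu>) * (\<nu> - \<mu> + 1)) * c n" for n
  proof -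
    define X q t where "X = complex_of_real x" and "q = complex_of_real r" and "t = (of_nat n :: complex)"
    have nzX: "1 - X \<noteq> 0" "1 + X \<noteq> 0" using one_minus_square_nonzero[OF of_real_in_unit_ball[OF x]] by (auto simp: X_def)
    have nz: "t + 1 \<noteq> 0" "t + 2 \<noteq> 0"
      using of_nat_neq_0[of n, where 'a=complex] of_nat_neq_0[of "Suc n", where 'a=complex]
      by (auto simp: t_def add_ac)
    define W where "W = q ^ n / fact n"
    define e0 e1 e2 where "e0 = order_coeff n" and "e1 = order_coeff (n+1)" and "e2 = order_coeff (n+2)"
    have cs: "c n = W * e0" "(t + 1) * c (n+1) = q * W * e1" "(t + 1) * (t + 2) * c (n+2) = q\<^sup>2 * W * e2"
      using nz unfolding c_def e0_def e1_def e2_def W_def q_def[symmetric]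
      by (simp_all add: fact_Suc t_def[symmetric] divide_simps power2_eq_square) (simp_all add: algebra_simps)
    have ll: "(1 - X\<^sup>2) * (l1 + l2) = - 2 * X * q" "(1 - X\<^sup>2) * (l1 * l2) = - q\<^sup>2" 
    proof -
      have q': "1 - X\<^sup>2 = (1 - X) * (1 + X)" by (simp add: power2_eq_square algebra_simps)
      have l: "l1 = - q / (1 - X)" "l2 = q / (1 + X)" by (simp_all add: l1_def l2_def X_def q_def)
      show "(1 - X\<^sup>2) * (l1 + l2) = - 2 * X * q" "(1 - X\<^sup>2) * (l1 * l2) = - q\<^sup>2"
        unfolding q' l using nzX by (simp_all add: divide_simps power2_eq_square) (simp_all add: algebra_simps)
    qed
    have "(1 - X\<^sup>2) * ((t+1) * (t+2) * c (n+2)) = q\<^sup>2 * W * ((1 - X\<^sup>2) * e2)" unfolding cs by simp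
    also have "(1 - X\<^sup>2) * e2 = 2 * (\<mu> - t - 1) * X * e1 - (\<nu> + \<mu> - t) * (\<nu> - \<mu> + t + 1) * e0"
      using order_coeff_recurrence[of n] by (simp add: X_def t_def e0_def e1_def e2_def algebra_simps)
    also have "q\<^sup>2 * W * \<dots> = (- 2 * X * q) * ((t + 2) - (1 + \<mu>)) * (q * W * e1)
       - (- q\<^sup>2) * (t\<^sup>2 + (3 - 2*(1 + \<mu>)) * t - (\<nu> + \<mu>) * (\<nu> - \<mu> + 1)) * (W * e0)"
      by (simp add: power2_eq_square algebra_simps)
    also have "\<dots> = (1 - X\<^sup>2) * ((l1 + l2) * (t + 1) * ((t + 2) - (1 + \<mu>)) * c (n+1)
      - l1 * l2 * (t\<^sup>2 + (3 - 2*(1 + \<mu>)) * t - (\<nu> + \<mu>) * (\<nu> - \<mu> + 1)) * c n)"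
      unfolding ll[symmetric] cs[symmetric] by (simp only: right_diff_distrib[of "1 - X\<^sup>2"] mult_ac)
    finally have "(t+1) * (t+2) * c (n+2) = (l1 + l2) * (t + 1) * ((t + 2) - (1 + \<mu>)) * c (n+1)
      - l1 * l2 * (t\<^sup>2 + (3 - 2*(1 + \<mu>)) * t - (\<nu> + \<mu>) * (\<nu> - \<mu> + 1)) * c n"
      using one_minus_square_nonzero(3)[OF of_real_in_unit_ball[OF x]] by (simp add: X_def)
    moreover have "of_nat (n+1) = t + 1" "of_nat (n+2) = t + 2" by (simp_all add: t_def)
    ultimately show ?thesis by (simp only: t_def)
  qed
  then have rec: "of_nat (n+1) * of_nat (n+2) * c (n+2) =
      (l1 + l2) * of_nat (n+1) * (of_nat (n+2) - (1 + \<mu>)) * c (n+1)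
      - l1 * l2 * ((of_nat n)\<^sup>2 + (3 - 2*(1 + \<mu>)) * of_nat n + (- ((\<nu> + \<mu>) * (\<nu> - \<mu> + 1)))) * c n" for n
    by (simp only: add_uminus_conv_diff)
  have "- r / (1 - x) < 0" "r / (1 + x) > 0" using r x by (simp_all add: divide_neg_pos)
  then have "l1 \<noteq> l2" unfolding l1_def l2_def of_real_eq_iff by linarith
  moreover have "\<bar>- r / (1 - x)\<bar> \<le> 1" "\<bar>r / (1 + x)\<bar> \<le> 1"
  proof -
    have "r \<le> 1 - x" "r \<le> 1 + x" by (simp_all add: r_def)
    then show "\<bar>- r / (1 - x)\<bar> \<le> 1" "\<bar>r / (1 + x)\<bar> \<le> 1"
      using x r by (simp_all add: abs_divide divide_le_eq_1)
  qed
  then have "norm l1 \<le> 1" "norm l2 \<le> 1" unfolding l1_def l2_def norm_of_real by blast+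
  ultimately have "summable (\<lambda>n. norm (c n))"
    using \<mu> by (intro second_order_recurrence_summable[OF rec]) auto
  then have "summable (\<lambda>n. norm (order_coeff n / fact n) * r ^ n)"
    using r by (simp add: c_def norm_mult norm_power norm_divide)
  from exp_generating_on_cball[OF r this order_germ] show ?thesis by (simp only: r_def)
qed

end

lemma legendre_coeff_eventually_zero:
  assumes "\<nu> \<in> \<int>"
  shows "\<exists>K. \<forall>c. \<forall>k\<ge>K. legendre_coeff \<nu> c k = 0"
proof -
  have "\<exists>m. \<nu> = of_nat m \<or> \<nu> + 1 = - of_nat m"
  proof -
    obtain i where i: "\<nu> = of_int i" using assms by (elim Ints_cases)
    show ?thesis
    proof (cases "i \<ge> 0")
      case True
      then show ?thesis using i by (intro exI[of _ "nat i"]) simp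
    next
      case False
      then have "\<nu> + 1 = - of_nat (nat (- i - 1))" using i by simp
      then show ?thesis by blast
    qed
  qed
  then obtain m where "\<nu> = of_nat m \<or> \<nu> + 1 = - of_nat m" ..
  then have "legendre_coeff \<nu> c k = 0" if "k \<ge> Suc m" for c k
    using that by (auto simp: legendre_coeff_def pochhammer_of_nat_eq_0_iff)
  then show ?thesis by blast
qed

lemma legendre_fps_conv_radius_integer:
  assumes "\<nu> \<in> \<int>"
  shows "fps_conv_radius (legendre_fps \<nu> c) = \<infinity>"
proof -
  obtain K where "\<And>k. k \<ge> K \<Longrightarrow> legendre_coeff \<nu> c k = 0"
    using legendre_coeff_eventually_zero[OF assms] by blast
  then have "\<forall>\<^sub>F k in sequentially. fps_nth (legendre_fps \<nu> c) k = 0"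
    by (auto simp: legendre_fps_def eventually_sequentially)
  then have "conv_radius (fps_nth (legendre_fps \<nu> c)) = conv_radius (\<lambda>_. 0 :: complex)"
    by (rule conv_radius_cong')
  then show ?thesis by (simp add: fps_conv_radius_def)
qed

lemma legendre_hyp_integer:
  assumes K: "\<And>k. k \<ge> K \<Longrightarrow> legendre_coeff \<nu> c k = 0"
  shows "legendre_hyp \<nu> c w = (\<Sum>k<K. legendre_coeff \<nu> c k * w ^ k)"
proof -
  have "legendre_hyp \<nu> c w = (\<Sum>k. legendre_coeff \<nu> c k * w ^ k)"
    by (simp add: hypergeo_reg_def legendre_coeff_def)
  also have "\<dots> = (\<Sum>k<K. legendre_coeff \<nu> c k * w ^ k)"
    by (rule suminf_finite) (use K in auto)
  finally show ?thesis .
qed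

lemma rGamma_over_fact_summable:
  assumes "Re \<alpha> > 0"
  shows "summable (\<lambda>n. norm (rGamma (1 + \<alpha> - of_nat n) / fact n))"
proof (rule raabe_summable[of _ "1 + Re \<alpha> / 2"])
  have "\<forall>\<^sub>F n in sequentially. norm (of_nat n + (- \<alpha>)) \<le> real n + (- Re \<alpha> / 2)"
    by (rule eventually_norm_of_nat_add_le) (use assms in simp)
  then show "\<forall>\<^sub>F n in sequentially. (real n + 1) * norm (rGamma (1 + \<alpha> - of_nat (Suc n)) / fact (Suc n))
      \<le> (real n + 1 - (1 + Re \<alpha> / 2)) * norm (rGamma (1 + \<alpha> - of_nat n) / fact n)"
  proof eventually_elim
    case (elim n)
    have "rGamma (1 + \<alpha> - of_nat (Suc n)) = (\<alpha> - of_nat n) * rGamma (1 + \<alpha> - of_nat n)"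
      using rGamma_plus1'[of "\<alpha> - of_nat n"] by (simp add: algebra_simps)
    moreover have "norm (z / fact (Suc n) :: complex) = norm z / ((real n + 1) * fact n)" for z
      by (simp only: norm_divide norm_fact) (simp add: add.commute)
    moreover have "norm (\<alpha> - of_nat n) = norm (of_nat n + (- \<alpha>))"
      using norm_minus_commute[of \<alpha> "of_nat n"] by simp
    ultimately have "(real n + 1) * norm (rGamma (1 + \<alpha> - of_nat (Suc n)) / fact (Suc n))
        = norm (of_nat n + (- \<alpha>)) * norm (rGamma (1 + \<alpha> - of_nat n) / fact n)"
      by (simp only: norm_mult norm_divide[of _ "fact n"] norm_fact) simp
    also have "\<dots> \<le> (real n + (- Re \<alpha> / 2)) * norm (rGamma (1 + \<alpha> - of_nat n) / fact n)"
      using elim by (intro mult_right_mono) auto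
    finally show ?case by simp
  qed
qed (use assms in auto)

lemma order_fun_integer_order:
  assumes "\<mu> \<in> \<int>"
  shows "\<exists>T. T holomorphic_on eball 0 (fps_conv_radius (legendre_fps \<nu> (1 + \<mu>))) \<and>
      (\<forall>u\<in>ball 0 1. order_fun \<nu> \<mu> u = T ((1 - u) / 2))"
proof -
  obtain m where m: "\<mu> = of_int m" using assms by (elim Ints_cases)
  define F where "F = legendre_fps \<nu> (1 + \<mu>)"
  have of: "order_fun \<nu> \<mu> u = exp (\<mu> * Ln (1 - u)) * eval_fps F ((1 - u) / 2)" for u
    by (simp add: order_fun_def F_def eval_legendre_fps)
  show ?thesis
  proof (cases "m \<ge> 0")
    case True
    define N where "N = nat m"
    have \<mu>: "\<mu> = of_nat N" using True m by (simp add: N_def)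
    have "(\<lambda>w. (2 * w) ^ N * eval_fps F w) holomorphic_on eball 0 (fps_conv_radius F)"
      by (intro holomorphic_intros) auto
    moreover have "order_fun \<nu> \<mu> u = (2 * ((1 - u) / 2)) ^ N * eval_fps F ((1 - u) / 2)" if "u \<in> ball 0 1" for u
      proof -
      have "2 * ((1 - u) / 2) = 1 - u" by simp
      then show ?thesis
        using one_minus_square_nonzero(1)[OF that] by (simp only: of) (simp add: \<mu> exp_of_nat_mult)
    qed
    ultimately show ?thesis unfolding F_def by blast
  next
    case False
    define N where "N = nat (- m)"
    have \<mu>: "\<mu> = - of_nat N" using False m by (simp add: N_def)
    have "fps_nth F k = 0" if "k < N" for k
    proof -
      have "1 + \<mu> + of_nat k = - of_nat (N - 1 - k)" using that by (simp add: \<mu> of_nat_diff)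
      then have "1 + \<mu> + of_nat k \<in> \<int>\<^sub>\<le>\<^sub>0" by simp
      then show ?thesis by (simp add: F_def legendre_fps_def legendre_coeff_def rGamma_eq_zero_iff)
    qed
    then have F: "F = fps_X ^ N * fps_shift N F" by (intro fps_ext) (simp add: fps_X_power_mult_nth)
    have ev: "eval_fps F w = w ^ N * eval_fps (fps_shift N F) w" if "norm w < 1" for w
    proof -
      have "ereal (norm w) < fps_conv_radius (fps_shift N F)"
        using legendre_fps_radius(1)[OF that, of \<nu> "1 + \<mu>"] by (simp add: F_def)
      then show ?thesis by (subst F) (simp add: eval_fps_mult)
    qed
    have "(\<lambda>w. eval_fps (fps_shift N F) w / 2 ^ N) holomorphic_on eball 0 (fps_conv_radius F)"
      by (intro holomorphic_intros) auto
    moreover have "order_fun \<nu> \<mu> u = eval_fps (fps_shift N F) ((1 - u) / 2) / 2 ^ N" if "u \<in> ball 0 1" for u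
      using one_minus_square_nonzero(1)[OF that] ev[OF norm_half_one_minus_less[OF that]]
      unfolding of by (simp add: \<mu> exp_minus exp_of_nat_mult power_divide field_simps)
    ultimately show ?thesis unfolding F_def by (intro exI[of _ "\<lambda>w. eval_fps (fps_shift N F) w / 2 ^ N"]) (simp add: F_def)
  qed
qed

lemma binomial_partial_sum_le_1:
  fixes w :: real
  assumes "0 \<le> w" "w \<le> 1"
  shows "(\<Sum>n<M. of_nat (N choose n) * w ^ (N - n) * (1 - w) ^ n) \<le> 1"
proof -
  have "(\<Sum>n<M. of_nat (N choose n) * w ^ (N - n) * (1 - w) ^ n) \<le> (\<Sum>n\<in>{..N} \<union> {..<M}. of_nat (N choose n) * w ^ (N - n) * (1 - w) ^ n)"
    using assms by (intro sum_mono2) auto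
  also have "\<dots> = (\<Sum>n\<le>N. of_nat (N choose n) * w ^ (N - n) * (1 - w) ^ n)"
    by (rule sum.mono_neutral_right) auto
  also have "\<dots> = ((1 - w) + w) ^ N"
    by (subst binomial_ring) (simp add: mult_ac)
  finally show ?thesis by simp
qed

lemma legendre_coeff_lower_order:
  "legendre_coeff \<nu> (1 + of_nat m - of_nat n) k / fact n = legendre_coeff \<nu> (1 + of_nat m) k * of_nat ((m + k) choose n)"
proof -
  have G: "rGamma (1 + of_nat j) = 1 / (fact j :: complex)" for j
    by (simp add: rGamma_inverse_Gamma Gamma_fact inverse_eq_divide)
  have "rGamma (1 + of_nat m - of_nat n + of_nat k) / fact n = rGamma (1 + of_nat m + of_nat k) * (of_nat ((m + k) choose n) :: complex)"
  proof (cases "n \<le> m + k")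
    case True
    have "1 + of_nat m - of_nat n + of_nat k = (1 + of_nat (m + k - n) :: complex)" using True by (simp add: of_nat_diff)
    moreover have "1 + of_nat m + of_nat k = (1 + of_nat (m + k) :: complex)" by simp
    moreover have "(of_nat ((m + k) choose n) :: complex) = fact (m + k) / (fact n * fact (m + k - n))"
      by (rule binomial_fact[OF True])
    ultimately show ?thesis unfolding G by (simp only: G) simp
  next
    case False
    then have "1 + of_nat m - of_nat n + of_nat k = (- of_nat (n - m - k - 1) :: complex)" by (simp add: of_nat_diff)
    then have "1 + of_nat m - of_nat n + of_nat k \<in> (\<int>\<^sub>\<le>\<^sub>0 :: complex set)" by simp
    then show ?thesis using False by (simp add: rGamma_eq_zero_iff binomial_eq_0)
  qed
  from arg_cong[OF this, of "\<lambda>z. pochhammer (- \<nu>) k * pochhammer (\<nu> + 1) k / fact k * z"] show ?thesis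
    by (simp add: legendre_coeff_def mult_ac)
qed

context
  fixes \<mu> \<nu> :: complex and x :: real
  assumes x: "-1 < x" "x < 1"
begin

lemma Ln_one_minus_x: "Ln (1 - complex_of_real x) = of_real (ln (1 - x))"
  using x Ln_of_real[of "1 - x"] by simp

lemma exp_ln_one_minus_x: "exp (complex_of_real (ln (1 - x))) = 1 - of_real x"
  using exp_Ln[of "1 - complex_of_real x"] one_minus_square_nonzero(1)[OF of_real_in_unit_ball[OF x]]
  by (simp add: Ln_one_minus_x)

lemma exp_generating_on_order_integer_degree_ball:
  assumes "\<nu> \<in> \<int>"
  shows "exp_generating_on (ball 0 (1 - x)) (order_coeff \<mu> \<nu> x) (order_generating_fun \<mu> \<nu> x)"
proof (rule exp_generating_on_order_holomorphic[OF x])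
  have "eval_fps (legendre_fps \<nu> (1 + \<mu>)) holomorphic_on UNIV"
    by (rule holomorphic_on_eval_fps) (simp add: legendre_fps_conv_radius_integer[OF assms])
  then have H: "legendre_hyp \<nu> (1 + \<mu>) holomorphic_on UNIV" by (simp add: eval_legendre_fps[abs_def])
  have "1 - (complex_of_real x - s) \<notin> \<real>\<^sub>\<le>\<^sub>0" if "s \<in> ball 0 (1 - x)" for s
  proof -
    have "\<bar>Re s\<bar> < 1 - x" using that abs_Re_le_cmod[of s] by simp
    then show ?thesis by (auto simp: complex_nonpos_Reals_iff)
  qed
  then show "(\<lambda>s. order_fun \<nu> \<mu> (of_real x - s)) holomorphic_on ball 0 (1 - x)"
    unfolding order_fun_def
    by (intro holomorphic_intros holomorphic_on_compose_gen[OF _ H, unfolded o_def]) auto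
qed auto

lemma exp_generating_on_order_integer_degree_cball:
  assumes \<nu>: "\<nu> \<in> \<int>" and \<mu>: "Re \<mu> > 0"
  shows "exp_generating_on (cball 0 (1 - x)) (order_coeff \<mu> \<nu> x) (order_generating_fun \<mu> \<nu> x)"
proof (rule exp_generating_on_cball[OF _ _ order_germ[OF x]])
  show "1 - x > 0" using x by simp
  obtain K where K: "\<And>c k. k \<ge> K \<Longrightarrow> legendre_coeff \<nu> c k = 0"
    using legendre_coeff_eventually_zero[OF \<nu>] by blast
  define C where "C = exp (\<mu> * of_real (ln (1 - x)))"
  define q where "q k = pochhammer (- \<nu>) k * pochhammer (\<nu> + 1) k / fact k * ((1 - of_real x) / 2) ^ k" for k
  have eq: "order_coeff \<mu> \<nu> x n / fact n * (1 - of_real x) ^ n =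
     C * (\<Sum>k<K. q k * (rGamma (1 + (\<mu> + of_nat k) - of_nat n) / fact n))" for n
  proof -
    have "exp ((\<mu> - of_nat n) * of_real (ln (1 - x))) * (1 - complex_of_real x) ^ n = C"
    proof -
      have "(1 - complex_of_real x) ^ n = exp (of_nat n * of_real (ln (1 - x)))"
        by (simp only: exp_of_nat_mult exp_ln_one_minus_x)
      then show ?thesis by (simp add: C_def algebra_simps flip: exp_add)
    qed
    then have "order_coeff \<mu> \<nu> x n / fact n * (1 - of_real x) ^ n = C * (legendre_hyp \<nu> (1 + (\<mu> - of_nat n)) ((1 - of_real x) / 2) / fact n)"
      by (simp add: order_coeff_eq[OF x] order_fun_def Ln_one_minus_x mult_ac) 
    also have "legendre_hyp \<nu> (1 + (\<mu> - of_nat n)) ((1 - of_real x) / 2) / fact n =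
        (\<Sum>k<K. q k * (rGamma (1 + (\<mu> + of_nat k) - of_nat n) / fact n))"
      by (subst legendre_hyp_integer[OF K])
         (auto simp: sum_divide_distrib legendre_coeff_def q_def algebra_simps intro!: sum.cong)
    finally show ?thesis .
  qed
  have "summable (\<lambda>n. norm C * (\<Sum>k<K. norm (q k) * norm (rGamma (1 + (\<mu> + of_nat k) - of_nat n) / fact n)))"
    using \<mu> by (intro summable_mult summable_sum rGamma_over_fact_summable) simp
  then show "summable (\<lambda>n. norm (order_coeff \<mu> \<nu> x n / fact n) * (1 - x) ^ n)"
  proof (rule summable_comparison_test'[of _ 0])
    fix n
    have "norm (norm (order_coeff \<mu> \<nu> x n / fact n) * (1 - x) ^ n) = norm (order_coeff \<mu> \<nu> x n / fact n * (1 - of_real x) ^ n)"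
    proof -
      have "1 - complex_of_real x = of_real (1 - x)" by simp
      then have "norm (1 - complex_of_real x) = 1 - x" using x by (simp only: norm_of_real)
      then show ?thesis using x by (simp add: norm_mult norm_power norm_divide)
    qed
    also have "\<dots> \<le> norm C * (\<Sum>k<K. norm (q k) * norm (rGamma (1 + (\<mu> + of_nat k) - of_nat n) / fact n))"
      unfolding eq norm_mult[of C] by (intro mult_left_mono sum_norm_le) (simp_all only: norm_mult norm_ge_zero order_refl)
    finally show "norm (norm (order_coeff \<mu> \<nu> x n / fact n) * (1 - x) ^ n) \<le>
        norm C * (\<Sum>k<K. norm (q k) * norm (rGamma (1 + (\<mu> + of_nat k) - of_nat n) / fact n))" .
  qed
qed

lemma exp_generating_on_order_integer_order:
  assumes \<mu>: "\<mu> \<in> \<int>"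
  shows "exp_generating_on (ball 0 (1 + x)) (order_coeff \<mu> \<nu> x) (order_generating_fun \<mu> \<nu> x)"
    and "\<nu> \<in> \<int> \<Longrightarrow> exp_generating_on UNIV (order_coeff \<mu> \<nu> x) (order_generating_fun \<mu> \<nu> x)"
proof -
  define R where "R = fps_conv_radius (legendre_fps \<nu> (1 + \<mu>))"
  obtain T where T: "T holomorphic_on eball 0 R" and eq: "\<And>u. u \<in> ball 0 1 \<Longrightarrow> order_fun \<nu> \<mu> u = T ((1 - u) / 2)"
    using order_fun_integer_order[OF \<mu>, of \<nu>] unfolding R_def by blast
  define G where "G s = T ((1 - (of_real x - s)) / 2)" for s
  have hol: "G holomorphic_on D" if "\<And>s. s \<in> D \<Longrightarrow> (1 - (of_real x - s)) / 2 \<in> eball 0 R" for D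
    unfolding G_def
    by (intro holomorphic_on_compose_gen[OF _ T, unfolded o_def] holomorphic_intros) (use that in auto)
  have G: "G s = order_fun \<nu> \<mu> (of_real x - s)" if "s \<in> ball 0 (1 - \<bar>x\<bar>)" for s
    using eq[OF of_real_minus_in_unit_ball[OF x that]] by (simp add: G_def)
  show "exp_generating_on (ball 0 (1 + x)) (order_coeff \<mu> \<nu> x) (order_generating_fun \<mu> \<nu> x)"
  proof (rule exp_generating_on_order_holomorphic[OF x hol _ _ G])
    fix s :: complex assume s: "s \<in> ball 0 (1 + x)"
    have "norm (complex_of_real (1 - x) + s) \<le> (1 - x) + norm s"
      using norm_triangle_ineq[of "complex_of_real (1 - x)" s] x by (simp only: norm_of_real)
    then have "norm ((1 - (of_real x - s)) / 2) < 1" using s by (simp add: norm_divide algebra_simps)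
    from legendre_fps_radius(1)[OF this, of \<nu> "1 + \<mu>"] show "(1 - (of_real x - s)) / 2 \<in> eball 0 R"
      by (simp add: R_def eball_def)
  qed auto
  show "exp_generating_on UNIV (order_coeff \<mu> \<nu> x) (order_generating_fun \<mu> \<nu> x)" if "\<nu> \<in> \<int>"
  proof (rule exp_generating_on_order_holomorphic[OF x hol _ _ G])
    show "(1 - (of_real x - s)) / 2 \<in> eball 0 R" for s
      by (simp add: R_def legendre_fps_conv_radius_integer[OF that])
    show "\<exists>r>norm s. ball 0 r \<subseteq> UNIV" for s :: complex by (auto intro: gt_ex)
  qed auto
qed

lemma exp_generating_on_order_integer_order_cball:
  assumes m: "\<mu> \<in> \<int>" and \<mu>: "Re \<mu> > 0"
  shows "exp_generating_on (cball 0 (1 + x)) (order_coeff \<mu> \<nu> x) (order_generating_fun \<mu> \<nu> x)"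
proof (rule exp_generating_on_cball[OF _ _ order_germ[OF x]])
  show "1 + x > 0" using x by simp
  obtain i where i: "\<mu> = of_int i" using m by (elim Ints_cases)
  define m where "m = nat i"
  have m: "\<mu> = of_nat m" "m > 0" using i \<mu> by (auto simp: m_def)
  define w where "w = (1 - x) / 2"
  have w: "0 < w" "w < 1" using x by (simp_all add: w_def)
  define h where "h k = legendre_coeff \<nu> (1 + \<mu>) k" for k
  define t where "t n k = real ((m + k) choose n) * w ^ (m + k - n) * (1 - w) ^ n" for n k
  have hs: "summable (\<lambda>k. norm (h k))" unfolding h_def using \<mu> by (intro legendre_coeff_summable) simp
  have t0: "t n k \<ge> 0" for n k using w by (simp add: t_def)
  have tsum: "(\<Sum>n<M. t n k) \<le> 1" for M k
    unfolding t_def using w by (intro binomial_partial_sum_le_1) auto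
  have t1: "t n k \<le> 1" for n k
    using member_le_sum[of n "{..<Suc n}" "\<lambda>n. t n k"] t0 tsum[of k "Suc n"] by (auto intro: order_trans)
  have ts: "summable (\<lambda>k. norm (h k) * t n k)" for n
    by (rule summable_comparison_test'[OF hs, of 0]) (use t0 t1 in \<open>simp add: abs_mult mult_left_le\<close>)
  have term_eq: "exp ((\<mu> - of_nat n) * of_real (ln (1 - x))) * (h k * of_nat ((m + k) choose n)) * of_real w ^ k * of_real (1 + x) ^ n
      = 2 ^ m * (h k * of_real (t n k))" for n k
  proof (cases "n \<le> m + k")
    case True
    define W where "W = complex_of_real w"
    define V where "V = 1 - W"
    have W: "W \<noteq> 0" using w by (simp add: W_def)
    have "exp (complex_of_real (ln (1 - x))) = 2 * W" by (simp add: exp_ln_one_minus_x W_def w_def)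
    then have "exp ((\<mu> - of_nat n) * of_real (ln (1 - x))) = (2 * W) ^ m / (2 * W) ^ n"
      by (simp add: m left_diff_distrib exp_diff exp_of_nat_mult W_def)
    moreover have "complex_of_real (1 + x) = 2 * V" by (simp add: w_def W_def V_def field_simps)
    moreover have "W ^ (m + k - n) = W ^ m * W ^ k / W ^ n" using W True by (simp add: power_diff power_add)
    moreover have "complex_of_real (t n k) = of_nat ((m + k) choose n) * W ^ (m + k - n) * V ^ n" by (simp add: t_def W_def V_def)
    ultimately show ?thesis using W by (simp only: W_def[symmetric] power_mult_distrib) simp
  qed (simp add: t_def binomial_eq_0)
  have eq: "norm (order_coeff \<mu> \<nu> x n / fact n) * (1 + x) ^ n \<le> 2 ^ m * (\<Sum>k. norm (h k) * t n k)" for n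
  proof -
    define A where "A = exp ((\<mu> - of_nat n) * of_real (ln (1 - x)))"
    have W: "norm (complex_of_real w) < 1" using w by simp
    have "summable (\<lambda>k. fps_nth (legendre_fps \<nu> (1 + (\<mu> - of_nat n))) k * of_real w ^ k)"
      by (rule summable_fps[OF legendre_fps_radius(1)[OF W]])
    then have "(\<lambda>k. legendre_coeff \<nu> (1 + (\<mu> - of_nat n)) k * of_real w ^ k) sums legendre_hyp \<nu> (1 + (\<mu> - of_nat n)) (of_real w)"
      unfolding eval_legendre_fps[symmetric] eval_fps_def by (simp add: legendre_fps_def summable_sums)
    from sums_mult[OF this, of "A * of_real (1 + x) ^ n / fact n"]
    have "(\<lambda>k. A * (legendre_coeff \<nu> (1 + of_nat m - of_nat n) k / fact n) * of_real w ^ k * of_real (1 + x) ^ n)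
       sums (A * of_real (1 + x) ^ n / fact n * legendre_hyp \<nu> (1 + (\<mu> - of_nat n)) (of_real w))"
      by (simp add: m mult_ac add_diff_eq)
    moreover have "A * of_real (1 + x) ^ n / fact n * legendre_hyp \<nu> (1 + (\<mu> - of_nat n)) (of_real w) = order_coeff \<mu> \<nu> x n / fact n * of_real (1 + x) ^ n"
      by (simp add: order_coeff_eq[OF x] order_fun_def Ln_one_minus_x A_def w_def)
    ultimately have sums: "(\<lambda>k. 2 ^ m * (h k * of_real (t n k))) sums (order_coeff \<mu> \<nu> x n / fact n * of_real (1 + x) ^ n)"
      unfolding legendre_coeff_lower_order term_eq[symmetric] by (simp only: h_def m A_def)
    have ab: "summable (\<lambda>k. norm (2 ^ m * (h k * complex_of_real (t n k))))"
      using summable_mult[OF ts[of n], of "2 ^ m"] t0 by (simp add: norm_mult norm_power)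
    have "norm (order_coeff \<mu> \<nu> x n / fact n * of_real (1 + x) ^ n) \<le> (\<Sum>k. norm (2 ^ m * (h k * complex_of_real (t n k))))"
      unfolding sums_unique[OF sums] by (rule summable_norm[OF ab])
    also have "(\<Sum>k. norm (2 ^ m * (h k * complex_of_real (t n k)))) = 2 ^ m * (\<Sum>k. norm (h k) * t n k)"
      using suminf_mult[OF ts[of n], of "2 ^ m"] t0 by (simp add: norm_mult norm_power)
    finally have "norm (order_coeff \<mu> \<nu> x n / fact n * of_real (1 + x) ^ n) \<le> 2 ^ m * (\<Sum>k. norm (h k) * t n k)" .
    moreover have "norm (complex_of_real (1 + x)) = 1 + x" unfolding norm_of_real using x by simp
    ultimately show ?thesis by (simp only: norm_mult norm_power)
  qed
  show "summable (\<lambda>n. norm (order_coeff \<mu> \<nu> x n / fact n) * (1 + x) ^ n)"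
  proof (rule summable_comparison_test'[of _ 0])
    show "summable (\<lambda>n. 2 ^ m * (\<Sum>k. norm (h k) * t n k))"
    proof (intro summable_mult summableI_nonneg_bounded)
      fix M
      have "(\<Sum>n<M. \<Sum>k. norm (h k) * t n k) = (\<Sum>k. \<Sum>n<M. norm (h k) * t n k)"
        by (rule suminf_sum[symmetric]) (rule ts)
      also have "\<dots> \<le> (\<Sum>k. norm (h k))"
      proof (rule suminf_le[OF _ _ hs])
        show "(\<Sum>n<M. norm (h k) * t n k) \<le> norm (h k)" for k
          using mult_left_mono[OF tsum[of k M], of "norm (h k)"] by (simp add: sum_distrib_left)
      qed (intro summable_sum ts)
      finally show "(\<Sum>n<M. \<Sum>k. norm (h k) * t n k) \<le> (\<Sum>k. norm (h k))" .
    qed (use t0 ts in \<open>auto intro!: suminf_nonneg\<close>)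
    show "norm (norm (order_coeff \<mu> \<nu> x n / fact n) * (1 + x) ^ n) \<le> 2 ^ m * (\<Sum>k. norm (h k) * t n k)" for n
      using eq[of n] x by simp
  qed
qed

end

lemma exp_generating_on_scale:
  fixes q :: real and \<kappa> :: complex
  assumes f: "exp_generating_on D a f" and q: "q > 0"
    and b: "\<And>n. b n = \<kappa> * a n * of_real q ^ n"
    and h: "\<And>s. h s = \<kappa> * f (of_real q * s)"
  shows "exp_generating_on {s. of_real q * s \<in> D} b h"
proof -
  obtain g where g: "g holomorphic_on interior D" "continuous_on D g" "\<forall>\<^sub>F s in nhds 0. g s = f s"
    and sums: "\<And>s. s \<in> D \<Longrightarrow> (\<lambda>n. a n * (s ^ n / fact n)) sums g s"
    using f unfolding exp_generating_on_def continuation_from_0_def by blast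
  define D' where "D' = {s. of_real q * s \<in> D}"
  have int: "of_real q * s \<in> interior D" if s: "s \<in> interior D'" for s :: complex
  proof (rule interiorI[of "(\<lambda>s. of_real q * s) ` interior D'"])
    show "open ((\<lambda>s. complex_of_real q * s) ` interior D')"
      using open_scaling[of q "interior D'"] q by (simp add: scaleR_conv_of_real)
    show "(\<lambda>s. of_real q * s) ` interior D' \<subseteq> D" using interior_subset[of D'] by (auto simp: D'_def)
  qed (use s in auto)
  show ?thesis
    unfolding exp_generating_on_def continuation_from_0_def D'_def[symmetric]
  proof (intro exI[of _ "\<lambda>s. \<kappa> * g (of_real q * s)"] conjI ballI)
    show "(\<lambda>s. \<kappa> * g (of_real q * s)) holomorphic_on interior D'"
      by (intro holomorphic_intros holomorphic_on_compose_gen[OF _ g(1), unfolded o_def]) (use int in auto)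
    show "continuous_on D' (\<lambda>s. \<kappa> * g (of_real q * s))"
      by (intro continuous_intros continuous_on_compose2[OF g(2)]) (auto simp: D'_def)
    have "((\<lambda>s. complex_of_real q * s) \<longlongrightarrow> 0) (nhds 0)"
      by (rule tendsto_eq_intros filterlim_ident refl | simp)+
    then have "\<forall>\<^sub>F s in nhds 0. g (of_real q * s) = f (of_real q * s)"
      using g(3) by (rule eventually_compose_filterlim[rotated])
    then show "\<forall>\<^sub>F s in nhds 0. \<kappa> * g (of_real q * s) = h s"
      by eventually_elim (simp add: h)
    fix s assume "s \<in> D'"
    then have "(\<lambda>n. a n * ((of_real q * s) ^ n / fact n)) sums g (of_real q * s)" by (intro sums) (simp add: D'_def)
    from sums_mult[OF this, of \<kappa>] show "(\<lambda>n. b n * (s ^ n / fact n)) sums (\<kappa> * g (of_real q * s))"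
      by (simp add: b power_mult_distrib mult_ac)
  qed
qed

lemma mu_disc_scale:
  assumes "q > 0"
  shows "{s. of_real q * s \<in> mu_disc \<mu> r} = mu_disc \<mu> (r / q)"
  using assms by (auto simp: mu_disc_def norm_mult field_simps)

lemma exp_generating_on_mu_disc:
  assumes "exp_generating_on (ball 0 r) a f" "Re \<mu> > 0 \<Longrightarrow> exp_generating_on (cball 0 r) a f"
  shows "exp_generating_on (mu_disc \<mu> r) a f"
  using assms by (simp add: mu_disc_def)

lemma powr_of_real_times:
  assumes "r > 0"
  shows "(complex_of_real r * z) powr a = of_real r powr a * z powr a"
  using assms Ln_times_of_real[of r z]
  by (cases "z = 0") (simp_all add: powr_def Ln_of_real algebra_simps exp_add)

lemma exp_generating_on_order:
  fixes \<mu> \<nu> :: complex and x :: real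
  assumes x: "-1 < x" "x < 1"
  shows "(\<nu> \<in> \<int> \<and> \<mu> \<in> \<int> \<longrightarrow> exp_generating_on UNIV (order_coeff \<mu> \<nu> x) (order_generating_fun \<mu> \<nu> x)) \<and>
     (\<nu> \<notin> \<int> \<and> \<mu> \<notin> \<int> \<longrightarrow> exp_generating_on (mu_disc \<mu> (1 - \<bar>x\<bar>)) (order_coeff \<mu> \<nu> x) (order_generating_fun \<mu> \<nu> x)) \<and>
     (\<nu> \<in> \<int> \<and> \<mu> \<notin> \<int> \<longrightarrow> exp_generating_on (mu_disc \<mu> (1 - x)) (order_coeff \<mu> \<nu> x) (order_generating_fun \<mu> \<nu> x)) \<and>
     (\<mu> \<in> \<int> \<and> \<nu> \<notin> \<int> \<longrightarrow> exp_generating_on (mu_disc \<mu> (1 + x)) (order_coeff \<mu> \<nu> x) (order_generating_fun \<mu> \<nu> x))"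
  using exp_generating_on_order_integer_order[OF x] exp_generating_on_order_ball[OF x] exp_generating_on_order_cball[OF x]
    exp_generating_on_order_integer_degree_ball[OF x] exp_generating_on_order_integer_degree_cball[OF x]
    exp_generating_on_order_integer_order_cball[OF x]
  by (intro conjI impI exp_generating_on_mu_disc) auto

lemma exp_generating_on_order_rescaled:
  fixes \<mu> \<nu> :: complex and x :: real
  assumes x: "-1 < x" "x < 1"
  defines "a3 \<equiv> \<lambda>n. ferrersP \<nu> (of_nat n - \<mu>) x"
    and "f3 \<equiv> \<lambda>s. (1 + 2 * s * of_real x / of_real (sqrt (1 - x\<^sup>2)) - s\<^sup>2) powr (\<mu> / 2) *
           ferrersP_hat \<nu> (- \<mu>) (of_real x - s * of_real (sqrt (1 - x\<^sup>2)))"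
  assumes D: "exp_generating_on D (order_coeff \<mu> \<nu> x) (order_generating_fun \<mu> \<nu> x)"
  shows "exp_generating_on {s. of_real (sqrt (1 - x\<^sup>2)) * s \<in> D} a3 f3"
proof (rule exp_generating_on_scale[OF D])
  define q where "q = sqrt (1 - x\<^sup>2)"
  define r where "r = 1 - x\<^sup>2"
  have r: "r > 0" using x by (simp add: r_def abs_square_less_1)
  have q: "q > 0" "q\<^sup>2 = r" using r by (simp_all add: q_def r_def)
  show "sqrt (1 - x\<^sup>2) > 0" using q by (simp add: q_def)
  define \<kappa> where "\<kappa> = complex_of_real r powr (- (\<mu> / 2))"
  have \<kappa>: "\<kappa> * complex_of_real r powr (\<mu> / 2) = 1" using r by (simp add: \<kappa>_def powr_minus)
  show "a3 n = complex_of_real (1 - x\<^sup>2) powr (- (\<mu> / 2)) * order_coeff \<mu> \<nu> x n * of_real (sqrt (1 - x\<^sup>2)) ^ n" for n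
  proof -
    have "complex_of_real r powr ((of_nat n - \<mu>) / 2) = \<kappa> * complex_of_real r powr (of_nat n / 2)"
      unfolding \<kappa>_def by (simp add: diff_divide_distrib flip: powr_add)
    also have "complex_of_real r powr (of_nat n / 2) = of_real q ^ n"
    proof -
      have "complex_of_real r powr (of_nat n / 2) = of_real (r powr (real n / 2))"
        using r powr_of_real[of r "real n / 2"] by simp
      also have "r powr (real n / 2) = q ^ n"
        using r by (simp add: q_def r_def[symmetric] powr_half_sqrt[symmetric] powr_powr flip: powr_realpow)
      finally show ?thesis by simp
    qed
    finally have e: "complex_of_real r powr ((of_nat n - \<mu>) / 2) = \<kappa> * of_real q ^ n" .
    have "\<kappa> \<noteq> 0" "q \<noteq> 0" using \<kappa> q by auto
    then show ?thesis
      unfolding a3_def order_coeff_def[OF x] q_def[symmetric]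
      unfolding r_def[symmetric] \<kappa>_def[symmetric] e by simp
  qed
  show "f3 s = complex_of_real (1 - x\<^sup>2) powr (- (\<mu> / 2)) * order_generating_fun \<mu> \<nu> x (of_real (sqrt (1 - x\<^sup>2)) * s)" for s
  proof -
    define Q where "Q = complex_of_real q"
    have Q: "Q \<noteq> 0" "Q\<^sup>2 = of_real r" using q by (auto simp: Q_def simp flip: of_real_power)
    have r': "complex_of_real r = 1 - (of_real x)\<^sup>2" by (simp add: r_def)
    have "1 - (of_real x - Q * s)\<^sup>2 = (1 - (of_real x)\<^sup>2) + 2 * of_real x * Q * s - Q\<^sup>2 * s\<^sup>2"
      by (simp add: power2_eq_square algebra_simps)
    also have "\<dots> = Q\<^sup>2 * (1 + 2 * s * of_real x / Q - s\<^sup>2)"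
      unfolding r'[symmetric] Q(2)[symmetric] using Q(1) by (simp add: power2_eq_square field_simps)
    finally have "1 - (of_real x - Q * s)\<^sup>2 = of_real r * (1 + 2 * s * of_real x / Q - s\<^sup>2)" unfolding Q(2) .
    then have "order_generating_fun \<mu> \<nu> x (Q * s) = of_real r powr (\<mu> / 2) * f3 s"
      unfolding order_generating_fun_def[OF x] f3_def q_def[symmetric] Q_def[symmetric]
      by (simp add: powr_of_real_times[OF r] mult_ac)
    then show ?thesis using \<kappa> by (simp add: Q_def q_def r_def[symmetric] \<kappa>_def[symmetric])
  qed
qed

lemma sqrt_quotient:
  fixes a b :: real
  assumes "a > 0" "b > 0"
  shows "a / sqrt (a * b) = sqrt a / sqrt b"
  using assms by (simp add: real_sqrt_mult field_simps)

theorem theorem21: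
  fixes \<mu> \<nu> :: complex and x :: real
  assumes "-1 < x" and "x < 1"
  defines "a1 \<equiv> \<lambda>n. pochhammer (\<mu> - \<nu>) n * ferrersP (of_nat n - \<nu> - 1) (- \<mu>) x"
    and "f1 \<equiv> \<lambda>s. (1 - 2 * s * of_real x + s\<^sup>2) powr (\<nu> / 2) *
           ferrersP_hat \<nu> (- \<mu>) ((of_real x - s) / csqrt (1 - 2 * s * of_real x + s\<^sup>2))"
    and "a2 \<equiv> \<lambda>n. ferrersP \<nu> (of_nat n - \<mu>) x /
           complex_of_real (1 - x\<^sup>2) powr ((of_nat n - \<mu>) / 2)"
    and "f2 \<equiv> \<lambda>s. (1 - (of_real x - s)\<^sup>2) powr (\<mu> / 2) * ferrersP_hat \<nu> (- \<mu>) (of_real x - s)"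
    and "a3 \<equiv> \<lambda>n. ferrersP \<nu> (of_nat n - \<mu>) x"
    and "f3 \<equiv> \<lambda>s. (1 + 2 * s * of_real x / of_real (sqrt (1 - x\<^sup>2)) - s\<^sup>2) powr (\<mu> / 2) *
           ferrersP_hat \<nu> (- \<mu>) (of_real x - s * of_real (sqrt (1 - x\<^sup>2)))"
  shows
   "((\<nu> - \<mu> \<in> \<nat> \<longrightarrow> exp_generating_on UNIV a1 f1) \<and>
     (\<nu> - \<mu> \<notin> \<nat> \<longrightarrow> exp_generating_on (ball 0 1) a1 f1) \<and>
     (\<nu> - \<mu> \<notin> \<nat> \<and> Re \<nu> > 1/2 \<longrightarrow> exp_generating_on (cball 0 1) a1 f1) \<and>
     (\<nu> - \<mu> \<notin> \<nat> \<and> -1/2 < Re \<nu> \<and> Re \<nu> \<le> 1/2 \<longrightarrow>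
        exp_generating_on
          (ball 0 1 \<union> {s. norm s = 1 \<and> Arg s \<noteq> arccos x \<and> Arg s \<noteq> - arccos x}) a1 f1))
    \<and>
    ((\<nu> \<in> \<int> \<and> \<mu> \<in> \<int> \<longrightarrow> exp_generating_on UNIV a2 f2) \<and>
     (\<nu> \<notin> \<int> \<and> \<mu> \<notin> \<int> \<longrightarrow> exp_generating_on (mu_disc \<mu> (1 - \<bar>x\<bar>)) a2 f2) \<and>
     (\<nu> \<in> \<int> \<and> \<mu> \<notin> \<int> \<longrightarrow> exp_generating_on (mu_disc \<mu> (1 - x)) a2 f2) \<and>
     (\<mu> \<in> \<int> \<and> \<nu> \<notin> \<int> \<longrightarrow> exp_generating_on (mu_disc \<mu> (1 + x)) a2 f2))
    \<and>
    ((\<nu> \<in> \<int> \<and> \<mu> \<in> \<int> \<longrightarrow> exp_generating_on UNIV a3 f3) \<and>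
     (\<nu> \<notin> \<int> \<and> \<mu> \<notin> \<int> \<longrightarrow> exp_generating_on (mu_disc \<mu> (sqrt (1 - \<bar>x\<bar>) / sqrt (1 + \<bar>x\<bar>))) a3 f3) \<and>
     (\<nu> \<in> \<int> \<and> \<mu> \<notin> \<int> \<longrightarrow> exp_generating_on (mu_disc \<mu> (sqrt (1 - x) / sqrt (1 + x))) a3 f3) \<and>
     (\<mu> \<in> \<int> \<and> \<nu> \<notin> \<int> \<longrightarrow> exp_generating_on (mu_disc \<mu> (sqrt (1 + x) / sqrt (1 - x))) a3 f3))"
proof (intro conjI)
  note x = assms(1,2)
  have a1: "degree_coeff \<mu> \<nu> x = a1" by (simp add: a1_def degree_coeff_def[OF x] fun_eq_iff)
  note deg = exp_generating_on_degree[OF x, where \<mu> = \<mu> and \<nu> = \<nu>, folded f1_def, unfolded a1]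
  show "\<nu> - \<mu> \<in> \<nat> \<longrightarrow> exp_generating_on UNIV a1 f1"
    "\<nu> - \<mu> \<notin> \<nat> \<longrightarrow> exp_generating_on (ball 0 1) a1 f1"
    "\<nu> - \<mu> \<notin> \<nat> \<and> Re \<nu> > 1/2 \<longrightarrow> exp_generating_on (cball 0 1) a1 f1"
    using deg by auto
  show "\<nu> - \<mu> \<notin> \<nat> \<and> -1/2 < Re \<nu> \<and> Re \<nu> \<le> 1/2 \<longrightarrow>
        exp_generating_on
          (ball 0 1 \<union> {s. norm s = 1 \<and> Arg s \<noteq> arccos x \<and> Arg s \<noteq> - arccos x}) a1 f1"
    using deg(3) by (auto elim!: exp_generating_on_subset)
  have a2: "order_coeff \<mu> \<nu> x = a2" by (simp add: a2_def order_coeff_def[OF x] fun_eq_iff)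
  have f2: "order_generating_fun \<mu> \<nu> x = f2" by (simp add: f2_def order_generating_fun_def[OF x] fun_eq_iff)
  note ord = exp_generating_on_order[OF x, of \<nu> \<mu>]
  show "\<nu> \<in> \<int> \<and> \<mu> \<in> \<int> \<longrightarrow> exp_generating_on UNIV a2 f2"
    "\<nu> \<notin> \<int> \<and> \<mu> \<notin> \<int> \<longrightarrow> exp_generating_on (mu_disc \<mu> (1 - \<bar>x\<bar>)) a2 f2"
    "\<nu> \<in> \<int> \<and> \<mu> \<notin> \<int> \<longrightarrow> exp_generating_on (mu_disc \<mu> (1 - x)) a2 f2"
    "\<mu> \<in> \<int> \<and> \<nu> \<notin> \<int> \<longrightarrow> exp_generating_on (mu_disc \<mu> (1 + x)) a2 f2"
    using ord unfolding a2 f2 by blast+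
  define q where "q = sqrt (1 - x\<^sup>2)"
  have q: "q > 0" using x by (simp add: q_def abs_square_less_1)
  have q': "q = sqrt ((1 - x) * (1 + x))" "q = sqrt ((1 + x) * (1 - x))" "q = sqrt ((1 - \<bar>x\<bar>) * (1 + \<bar>x\<bar>))"
    unfolding q_def by (auto simp: power2_eq_square algebra_simps)
  have radius: "(1 - x) / q = sqrt (1 - x) / sqrt (1 + x)"
    unfolding q'(1) by (rule sqrt_quotient) (use x in auto)
  have radius': "(1 + x) / q = sqrt (1 + x) / sqrt (1 - x)"
    unfolding q'(2) by (rule sqrt_quotient) (use x in auto)
  have radius'': "(1 - \<bar>x\<bar>) / q = sqrt (1 - \<bar>x\<bar>) / sqrt (1 + \<bar>x\<bar>)"
    unfolding q'(3) by (rule sqrt_quotient) (use x in auto)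
  note res = exp_generating_on_order_rescaled[OF x, of _ \<mu> \<nu>, folded a3_def f3_def q_def]
  have res': "exp_generating_on (mu_disc \<mu> (r / q)) a3 f3"
    if "exp_generating_on (mu_disc \<mu> r) (order_coeff \<mu> \<nu> x) (order_generating_fun \<mu> \<nu> x)" for r
    using res[OF that] unfolding mu_disc_scale[OF q] .
  show "\<nu> \<in> \<int> \<and> \<mu> \<in> \<int> \<longrightarrow> exp_generating_on UNIV a3 f3"
    using ord res[of UNIV] by simp
  show "\<nu> \<notin> \<int> \<and> \<mu> \<notin> \<int> \<longrightarrow> exp_generating_on (mu_disc \<mu> (sqrt (1 - \<bar>x\<bar>) / sqrt (1 + \<bar>x\<bar>))) a3 f3"
    "\<nu> \<in> \<int> \<and> \<mu> \<notin> \<int> \<longrightarrow> exp_generating_on (mu_disc \<mu> (sqrt (1 - x) / sqrt (1 + x))) a3 f3"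
    "\<mu> \<in> \<int> \<and> \<nu> \<notin> \<int> \<longrightarrow> exp_generating_on (mu_disc \<mu> (sqrt (1 + x) / sqrt (1 - x))) a3 f3"
    using ord res'[of "1 - \<bar>x\<bar>"] res'[of "1 - x"] res'[of "1 + x"] unfolding radius radius' radius'' by blast+
qed

end
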